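(* Let $\sigma_\xi>0$ and $\rho\in(-1,0)$, and let $(Y_t)_{t\ge1}$ be the gaussian convolution-based Markov process with parameters $\rho$ and $\sigma_\xi$ defined in the context. Then $(Y_t)_{t\ge1}$ is $\beta$-mixing.
   Context: The gaussian convolution-based Markov process with parameters $\rho$ and $\sigma_\xi$ is a real-valued discrete-time Markov process $(Y_t)_{t\geq 0}$ satisfying $$Y_t=Y_{t-1}+\xi_t\quad(t\ge1),\qquad Y_0=0,$$ where the innovations $(\xi_t)_{t\ge1}$ are identically distributed, gaussian, with mean zero and standard deviation $\sigma_\xi$, and where, for every $t\ge2$, the copula of the pair $(Y_{t-1},\xi_t)$ is the bivariate gaussian copula with the same (time-invariant) correlation parameter $\rho$. In particular $Y_1=\xi_1$. The gaussian copula with parameter $\rho$ is the copula of a bivariate normal vector with standard normal margins and correlation $\rho$; the copula $C$ of a pair $(X,Z)$ is given by Sklar's theorem: $P(X\le x,Z\le z)=C(F_X(x),F_Z(z))$. For $1\le t\le l\le+\infty$ let $\mathcal{F}_t^l=\sigma(Y_s,\ t\le s\le l)$ (with $s$ a finite integer). For $t,k\ge1$ define $$\tilde\beta(\mathcal{F}_{1}^{t},\mathcal{F}_{t+k}^{+\infty})=\sup_{\{A_i\},\{B_j\}}\frac12\sum_{i=1}^I\sum_{j=1}^J\left|P(A_i\cap B_j)-P(A_i)P(B_j)\right|,$$ where the supremum is over all finite partitions $\{A_1,\dots,A_I\}$ and $\{B_1,\dots,B_J\}$ of the sample space $\Omega$ with $A_i\in\mathcal{F}_{1}^t$ for each $i$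 and $B_j\in\mathcal{F}_{t+k}^{+\infty}$ for each $j$. Put $\beta_k=\sup_{t\ge1}\tilde\beta(\mathcal{F}_{1}^{t},\mathcal{F}_{t+k}^{+\infty})$. The sequence $(Y_t)_{t\ge1}$ is called $\beta$-mixing (or absolutely regular) if $\beta_k\to0$ as $k\to+\infty$. *)

theory Defs
  imports "HOL-Probability.Probability"
begin

subsection \<open>Copulas\<close>

text \<open>Only the values on the closed unit square are meaningful; outside of it \<open>C\<close> is arbitrary.\<close>

definition is_copula :: "(real \<Rightarrow> real \<Rightarrow> real) \<Rightarrow> bool" where
  "is_copula C \<longleftrightarrow>
     (\<forall>u\<in>{0..1}. C u 0 = 0 \<and> C 0 u = 0 \<and> C u 1 = u \<and> C 1 u = u) \<and>
     (\<forall>u\<in>{0..1}. \<forall>u'\<in>{0..1}. \<forall>v\<in>{0..1}. \<forall>v'\<in>{0..1}. u \<le> u' \<longrightarrow> v \<le> v' \<longrightarrow>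
        0 \<le> C u' v' - C u' v - C u v' + C u v)"

text \<open>
  The relation of Sklar's theorem. It determines \<open>C\<close> on the unit square when both marginal
  distribution functions are continuous.
\<close>

definition has_copula ::
  "'a measure \<Rightarrow> ('a \<Rightarrow> real) \<Rightarrow> ('a \<Rightarrow> real) \<Rightarrow> (real \<Rightarrow> real \<Rightarrow> real) \<Rightarrow> bool" where
  "has_copula M X Z C \<longleftrightarrow> is_copula C \<and>
     (\<forall>x z. measure M {\<omega> \<in> space M. X \<omega> \<le> x \<and> Z \<omega> \<le> z} =
            C (cdf (distr M borel X) x) (cdf (distr M borel Z) z))"

text \<open>
  Law of a bivariate normal vector with standard normal margins and correlation \<open>\<rho>\<close>.
  The density exists only in the nondegenerate case \<open>\<bar>\<rho>\<bar> < 1\<close>, to which all uses are confined.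
\<close>

definition bivariate_std_normal :: "real \<Rightarrow> (real \<times> real) measure" where
  "bivariate_std_normal \<rho> = density (lborel \<Otimes>\<^sub>M lborel)
     (\<lambda>(x, y). ennreal (1 / (2 * pi * sqrt (1 - \<rho>\<^sup>2)) *
        exp (- (x\<^sup>2 - 2 * \<rho> * x * y + y\<^sup>2) / (2 * (1 - \<rho>\<^sup>2)))))"

definition is_gaussian_copula :: "real \<Rightarrow> (real \<Rightarrow> real \<Rightarrow> real) \<Rightarrow> bool" where
  "is_gaussian_copula \<rho> C \<longleftrightarrow> has_copula (bivariate_std_normal \<rho>) fst snd C"


subsection \<open>Markov processes\<close>

definition generated_sigma ::
  "'a measure \<Rightarrow> (nat \<Rightarrow> 'a \<Rightarrow> real) \<Rightarrow> nat set \<Rightarrow> 'a measure" where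
  "generated_sigma M Y S =
     sigma (space M) (\<Union>s\<in>S. {Y s -` A \<inter> space M | A. A \<in> sets borel})"

definition markov_process :: "'a measure \<Rightarrow> (nat \<Rightarrow> 'a \<Rightarrow> real) \<Rightarrow> bool" where
  "markov_process M Y \<longleftrightarrow>
     (\<forall>t. Y t \<in> borel_measurable M) \<and>
     (\<forall>t. \<forall>A\<in>sets borel. AE \<omega> in M.
        real_cond_exp M (generated_sigma M Y {0..t}) (indicator (Y (Suc t) -` A \<inter> space M)) \<omega> =
        real_cond_exp M (generated_sigma M Y {t}) (indicator (Y (Suc t) -` A \<inter> space M)) \<omega>)"

text \<open>
  All pairs \<open>(Y (t - 1), \<xi> t)\<close> with \<open>t \<ge> 2\<close> share one copula \<open>C\<close>. The index \<open>t = 1\<close> is excluded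
  because \<open>Y 0\<close> is constant; the value \<open>\<xi> 0\<close> is not used.
\<close>

locale gaussian_convolution_markov_process = prob_space M
  for M :: "'a measure" and Y \<xi> :: "nat \<Rightarrow> 'a \<Rightarrow> real" and \<rho> \<sigma> :: real +
  assumes markov: "markov_process M Y"
    and start: "\<And>\<omega>. \<omega> \<in> space M \<Longrightarrow> Y 0 \<omega> = 0"
    and step: "\<And>t \<omega>. t \<ge> 1 \<Longrightarrow> \<omega> \<in> space M \<Longrightarrow> Y t \<omega> = Y (t - 1) \<omega> + \<xi> t \<omega>"
    and innovation: "\<And>t. t \<ge> 1 \<Longrightarrow> distributed M lborel (\<xi> t) (normal_density 0 \<sigma>)"
    and copula: "\<exists>C. is_gaussian_copula \<rho> C \<and> (\<forall>t\<ge>2. has_copula M (Y (t - 1)) (\<xi> t) C)"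


subsection \<open>Absolute regularity\<close>

text \<open>
  \<^const>\<open>partition_on\<close> excludes the empty set, which would contribute only zero terms.
  The real suprema are over nonempty sets bounded by 1 when \<open>M\<close> is a probability space and
  \<open>F\<close>, \<open>G\<close> are sub-sigma-algebras of \<open>M\<close>.
\<close>

definition finite_partitions :: "'a measure \<Rightarrow> 'a set set set" where
  "finite_partitions F = {P. finite P \<and> partition_on (space F) P \<and> P \<subseteq> sets F}"

definition beta_dependence :: "'a measure \<Rightarrow> 'a measure \<Rightarrow> 'a measure \<Rightarrow> real" where
  "beta_dependence M F G =
     (SUP (P, Q) \<in> finite_partitions F \<times> finite_partitions G.
        1 / 2 * (\<Sum>A\<in>P. \<Sum>B\<in>Q. \<bar>measure M (A \<inter> B) - measure M A * measure M B\<bar>))"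

definition beta_coeff :: "'a measure \<Rightarrow> (nat \<Rightarrow> 'a \<Rightarrow> real) \<Rightarrow> nat \<Rightarrow> real" where
  "beta_coeff M Y k =
     (SUP t\<in>{1..}. beta_dependence M (generated_sigma M Y {1..t}) (generated_sigma M Y {t + k..}))"

definition beta_mixing :: "'a measure \<Rightarrow> (nat \<Rightarrow> 'a \<Rightarrow> real) \<Rightarrow> bool" where
  "beta_mixing M Y \<longleftrightarrow> beta_coeff M Y \<longlonglongrightarrow> 0"

end

theory Submission
  imports Defs
begin

text \<open>
  A Gaussian copula with Gaussian margins gives a bivariate normal pair, so \<open>\<xi>\<^sub>t\<^sub>+\<^sub>1\<close> given
  \<open>Y\<^sub>t = y\<close> is normal with mean \<open>(\<rho>\<sigma>/s\<^sub>t) y\<close> and variance \<open>v\<^sup>2 = \<sigma>\<^sup>2(1 - \<rho>\<^sup>2)\<close>, where \<open>s\<^sub>t\<close> is the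
  standard deviation of \<open>Y\<^sub>t\<close>. With the Markov property, \<open>Y\<close> is therefore a time-inhomogeneous
  autoregression: given the past, \<open>Y\<^sub>t\<^sub>+\<^sub>1\<close> is normal with mean \<open>a\<^sub>t Y\<^sub>t\<close> and variance \<open>v\<^sup>2\<close>, where
  \<open>a\<^sub>t = 1 + \<rho>\<sigma>/s\<^sub>t\<close>.

  For an event \<open>G\<close> of the future after time \<open>t + k\<close>, the conditional probability of \<open>G\<close> given the past
  up to time \<open>t + k\<close> is some function \<open>h\<close> of \<open>Y\<^sub>t\<^sub>+\<^sub>k\<close> with values in the unit interval. One
  transition backwards turns \<open>h\<close> into a Lipschitz function, because translating the normal density by
  \<open>d\<close> changes it by at most \<open>2d/v\<close> in total mass; each further transition multiplies the Lipschitz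
  constant by \<open>\<bar>a\<^sub>i\<bar>\<close>. So the conditional probability of \<open>G\<close> given the past up to time \<open>t\<close> is a
  Lipschitz function of \<open>Y\<^sub>t\<close> with constant \<open>(2/v) \<bar>a\<^sub>t \<cdots> a\<^sub>t\<^sub>+\<^sub>k\<^sub>-\<^sub>1\<bar>\<close>
  (\<open>predictor_lipschitz\<close>). It differs from its mean by little when this constant times
  \<open>E\<bar>Y\<^sub>t\<bar>\<close> is small, and this bounds the coefficient of absolute regularity, since the double
  sum over two partitions reduces, for each cell of the first one, to the covariance with a single
  future event (\<open>sum_abs_covariance_partition\<close>).

  A single slope \<open>a\<^sub>i\<close> can exceed 1 in absolute value when \<open>\<rho>\<close> is close to \<open>-1\<close>. What contracts is the
  correlation \<open>a\<^sub>i s\<^sub>i / s\<^sub>i\<^sub>+\<^sub>1\<close> of consecutive states. Its square is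
  \<open>1 - v\<^sup>2 / s\<^sub>i\<^sub>+\<^sub>1\<^sup>2\<close>, and negative dependence keeps \<open>s\<^sub>i\<close> below \<open>\<sigma>/\<bar>\<rho>\<bar>\<close>
  (\<open>std_dev_le\<close>), whereas for \<open>\<rho> \<ge> 0\<close> it would grow without bound. Hence
  \<open>\<bar>a\<^sub>t \<cdots> a\<^sub>t\<^sub>+\<^sub>k\<^sub>-\<^sub>1\<bar> s\<^sub>t \<le> r\<^sup>k \<sigma>/\<bar>\<rho>\<bar>\<close> with
  \<open>r\<^sup>2 = 1 - \<rho>\<^sup>2(1 - \<rho>\<^sup>2) < 1\<close>, and the process is absolutely regular at an exponential rate.
\<close>

section \<open>Centred Gaussian laws\<close>

definition gauss :: "real \<Rightarrow> real measure" where
  "gauss s = density lborel (\<lambda>x. ennreal (normal_density 0 s x))"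

lemma sets_gauss [simp, measurable_cong]: "sets (gauss s) = sets borel"
  by (simp add: gauss_def)

lemma space_gauss [simp]: "space (gauss s) = UNIV"
  by (simp add: gauss_def)

lemma prob_space_gauss: "0 < s \<Longrightarrow> prob_space (gauss s)"
  unfolding gauss_def by (rule prob_space_normal_density)

lemma distributed_iff_gauss:
  assumes "X \<in> borel_measurable M"
  shows "distributed M lborel X (normal_density 0 s) \<longleftrightarrow> distr M borel X = gauss s"
  using assms unfolding distributed_def gauss_def
  by (auto cong: distr_cong)

lemma distr_gauss_scale:
  assumes "0 < s" "0 < c"
  shows "distr (gauss s) borel (\<lambda>x. c * x) = gauss (c * s)"
proof -
  interpret prob_space "gauss s" by (rule prob_space_gauss) fact
  have "distr (gauss s) borel (\<lambda>x. x) = gauss s"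
    by (rule distr_id2) simp
  then have "distributed (gauss s) lborel (\<lambda>x. x) (normal_density 0 s)"
    by (subst distributed_iff_gauss) auto
  from normal_density_affine[OF this, of c 0] assms
  have "distributed (gauss s) lborel (\<lambda>x. c * x) (normal_density 0 (c * s))"
    by simp
  then show ?thesis
    by (subst (asm) distributed_iff_gauss) auto
qed

lemma distr_gauss_pair_affine:
  assumes s: "0 < s" and v: "0 < v"
  shows "distr (gauss s \<Otimes>\<^sub>M gauss v) borel (\<lambda>(y, e). a * y + e) = gauss (sqrt (a\<^sup>2 * s\<^sup>2 + v\<^sup>2))"
proof -
  interpret S: prob_space "gauss s" by (rule prob_space_gauss) fact
  interpret V: prob_space "gauss v" by (rule prob_space_gauss) fact
  interpret P: pair_prob_space "gauss s" "gauss v" ..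
  have fst: "distr (gauss s \<Otimes>\<^sub>M gauss v) (gauss s) fst = gauss s"
    by (rule V.distr_pair_fst)
  have snd: "distr (gauss s \<Otimes>\<^sub>M gauss v) (gauss v) snd = gauss v"
  proof (rule measure_eqI)
    fix A assume "A \<in> sets (distr (gauss s \<Otimes>\<^sub>M gauss v) (gauss v) snd)"
    then have "A \<in> sets (gauss v)" by simp
    moreover have "snd -` A \<inter> space (gauss s \<Otimes>\<^sub>M gauss v) = space (gauss s) \<times> A"
      by (auto simp: space_pair_measure)
    ultimately show "emeasure (distr (gauss s \<Otimes>\<^sub>M gauss v) (gauss v) snd) A = emeasure (gauss v) A"
      using V.emeasure_pair_measure_Times[of "space (gauss s)" "gauss s" A] S.emeasure_space_1
      by (simp add: emeasure_distr)
  qed simp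
  have fst': "distr (gauss s \<Otimes>\<^sub>M gauss v) borel fst = gauss s"
    using fst by (simp cong: distr_cong)
  have snd': "distr (gauss s \<Otimes>\<^sub>M gauss v) borel snd = gauss v"
    using snd by (simp cong: distr_cong)
  have sd: "distributed (gauss s \<Otimes>\<^sub>M gauss v) lborel snd (normal_density 0 v)"
    using snd' by (subst distributed_iff_gauss) auto
  have fd: "distributed (gauss s \<Otimes>\<^sub>M gauss v) lborel fst (normal_density 0 s)"
    using fst' by (subst distributed_iff_gauss) auto
  have "P.indep_var borel fst borel snd"
    unfolding P.indep_var_distribution_eq
    using fst' snd'
    by (auto simp: split_beta' intro!: distr_id2[symmetric] sets_pair_measure_cong)
  then have ind: "P.indep_var borel (\<lambda>x. a * fst x) borel snd"
    by (rule P.indep_var_compose[unfolded comp_def, of borel fst borel snd "\<lambda>x. a * x" borel "\<lambda>x. x" borel]) auto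
  show ?thesis
  \<comment> \<open>A constant summand is not covered by the sum of independent normals with positive variances.\<close>
  proof (cases "a = 0")
    case True
    then show ?thesis using snd' v by (simp add: split_beta')
  next
    case False
    have "distributed (gauss s \<Otimes>\<^sub>M gauss v) lborel (\<lambda>x. a * fst x) (normal_density 0 (\<bar>a\<bar> * s))"
      using P.normal_density_affine[OF fd s False, of 0] by simp
    from P.add_indep_normal[OF ind _ v this sd] False s
    have "distributed (gauss s \<Otimes>\<^sub>M gauss v) lborel (\<lambda>x. a * fst x + snd x)
       (normal_density 0 (sqrt (a\<^sup>2 * s\<^sup>2 + v\<^sup>2)))"
      by (simp add: power_mult_distrib)
    then show ?thesis
      by (subst (asm) distributed_iff_gauss) (auto simp: split_beta')
  qed
qed

section \<open>The joint law of a state and the next innovation\<close>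

text \<open>
  Conditional decomposition of the bivariate normal law: its second coordinate is \<open>\<rho>\<close> times the
  first plus an independent normal variable of variance \<open>1 - \<rho>\<^sup>2\<close>. Completing the square in the
  density and translating the second variable show it.
\<close>

lemma bivariate_std_normal_shear:
  assumes r: "\<bar>\<rho>\<bar> < 1"
  shows "bivariate_std_normal \<rho> =
    distr (gauss 1 \<Otimes>\<^sub>M gauss (sqrt (1 - \<rho>\<^sup>2))) (borel \<Otimes>\<^sub>M borel) (\<lambda>(x, z). (x, \<rho> * x + z))"
    (is "?B = ?D")
proof (rule measure_eqI)
  show "sets ?B = sets ?D"
    by (simp add: bivariate_std_normal_def cong: sets_pair_measure_cong)
next
  fix A assume "A \<in> sets ?B"
  then have A[measurable]: "A \<in> sets (borel \<Otimes>\<^sub>M borel)"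
    by (simp add: bivariate_std_normal_def cong: sets_pair_measure_cong)
  define v where "v = sqrt (1 - \<rho>\<^sup>2)"
  have q: "1 - \<rho>\<^sup>2 > 0" using r by (simp add: abs_square_less_1)
  have v: "v > 0" "v\<^sup>2 = 1 - \<rho>\<^sup>2" using q by (auto simp: v_def)
  interpret V: prob_space "gauss v" by (rule prob_space_gauss) fact
  have dens: "ennreal (1 / (2 * pi * sqrt (1 - \<rho>\<^sup>2)) *
        exp (- (x\<^sup>2 - 2 * \<rho> * x * (\<rho> * x + z) + (\<rho> * x + z)\<^sup>2) / (2 * (1 - \<rho>\<^sup>2))))
     = ennreal (normal_density 0 1 x) * ennreal (normal_density 0 v z)" for x z
  proof -
    have "x\<^sup>2 - 2 * \<rho> * x * (\<rho> * x + z) + (\<rho> * x + z)\<^sup>2 = (1 - \<rho>\<^sup>2) * x\<^sup>2 + z\<^sup>2"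
      by (simp add: power2_eq_square algebra_simps)
    then have e': "- (x\<^sup>2 - 2 * \<rho> * x * (\<rho> * x + z) + (\<rho> * x + z)\<^sup>2) / (2 * (1 - \<rho>\<^sup>2))
       = - (v\<^sup>2 * x\<^sup>2 + z\<^sup>2) / (2 * v\<^sup>2)"
      unfolding v(2) by (simp only:)
    have e: "- (x\<^sup>2 - 2 * \<rho> * x * (\<rho> * x + z) + (\<rho> * x + z)\<^sup>2) / (2 * (1 - \<rho>\<^sup>2))
       = - x\<^sup>2 / 2 + - z\<^sup>2 / (2 * v\<^sup>2)"
      unfolding e' using v(1) by (simp add: field_simps)
    have "normal_density 0 1 x * normal_density 0 v z =
       1 / (2 * pi * sqrt (1 - \<rho>\<^sup>2)) * exp (- x\<^sup>2 / 2 + - z\<^sup>2 / (2 * v\<^sup>2))"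
    proof -
      have "sqrt (2 * pi) * sqrt (2 * pi * v\<^sup>2) = 2 * pi * sqrt (1 - \<rho>\<^sup>2)"
        using v(1) unfolding v_def[symmetric] real_sqrt_mult[of "2 * pi" "v\<^sup>2"]
        by (simp only: mult.assoc[symmetric]) simp
      then have c: "1 / (2 * pi * sqrt (1 - \<rho>\<^sup>2)) = 1 / sqrt (2 * pi) * (1 / sqrt (2 * pi * v\<^sup>2))"
        by simp
      show ?thesis
        unfolding normal_density_def exp_add c by simp
    qed
    then show ?thesis unfolding e by (simp add: ennreal_mult[symmetric])
  qed
  have "emeasure ?B A = (\<integral>\<^sup>+x. \<integral>\<^sup>+y. ennreal (1 / (2 * pi * sqrt (1 - \<rho>\<^sup>2)) *
        exp (- (x\<^sup>2 - 2 * \<rho> * x * y + y\<^sup>2) / (2 * (1 - \<rho>\<^sup>2)))) * indicator A (x, y) \<partial>lborel \<partial>lborel)"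
    unfolding bivariate_std_normal_def
    by (subst emeasure_density) (auto simp: split_beta' lborel.nn_integral_fst[symmetric]
       cong: sets_pair_measure_cong)
  also have "\<dots> = (\<integral>\<^sup>+x. \<integral>\<^sup>+z. ennreal (normal_density 0 1 x) * ennreal (normal_density 0 v z) *
      indicator A (x, \<rho> * x + z) \<partial>lborel \<partial>lborel)"
  proof (rule nn_integral_cong)
    fix x :: real
    show "(\<integral>\<^sup>+y. ennreal (1 / (2 * pi * sqrt (1 - \<rho>\<^sup>2)) *
        exp (- (x\<^sup>2 - 2 * \<rho> * x * y + y\<^sup>2) / (2 * (1 - \<rho>\<^sup>2)))) * indicator A (x, y) \<partial>lborel) =
       (\<integral>\<^sup>+z. ennreal (normal_density 0 1 x) * ennreal (normal_density 0 v z) *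
      indicator A (x, \<rho> * x + z) \<partial>lborel)"
      by (subst nn_integral_real_affine[where c=1 and t="\<rho> * x"])
         (measurable, simp_all only: dens mult_1_left abs_one ennreal_1 one_neq_zero not_False_eq_True)
  qed
  also have "\<dots> = (\<integral>\<^sup>+x. \<integral>\<^sup>+z. indicator A (x, \<rho> * x + z) \<partial>gauss v \<partial>gauss 1)"
    unfolding gauss_def
    by (simp add: nn_integral_density nn_integral_cmult[symmetric] mult.assoc)
  also have "\<dots> = emeasure ?D A"
    unfolding v_def[symmetric]
    by (subst nn_integral_indicator[symmetric], simp, subst nn_integral_distr)
       (auto simp: split_beta' V.nn_integral_fst[symmetric])
  finally show "emeasure ?B A = emeasure ?D A" .
qed

lemma distr_fst_bivariate_std_normal:
  assumes "\<bar>\<rho>\<bar> < 1"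
  shows "distr (bivariate_std_normal \<rho>) borel fst = gauss 1"
proof -
  define v where "v = sqrt (1 - \<rho>\<^sup>2)"
  have v: "v > 0" using assms by (simp add: v_def abs_square_less_1)
  interpret V: prob_space "gauss v" by (rule prob_space_gauss) fact
  have "distr (gauss 1 \<Otimes>\<^sub>M gauss v) (gauss 1) fst = gauss 1"
    by (rule V.distr_pair_fst)
  then have *: "distr (gauss 1 \<Otimes>\<^sub>M gauss v) borel fst = gauss 1"
    by (simp cong: distr_cong)
  show ?thesis
    unfolding bivariate_std_normal_shear[OF assms] v_def[symmetric]
    by (subst distr_distr) (auto simp: comp_def split_beta' *)
qed

lemma distr_snd_bivariate_std_normal:
  assumes "\<bar>\<rho>\<bar> < 1"
  shows "distr (bivariate_std_normal \<rho>) borel snd = gauss 1"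
proof -
  define v where "v = sqrt (1 - \<rho>\<^sup>2)"
  have v: "v > 0" "v\<^sup>2 = 1 - \<rho>\<^sup>2"
    using assms by (auto simp: v_def abs_square_less_1 abs_square_le_1)
  have *: "distr (gauss 1 \<Otimes>\<^sub>M gauss v) borel (\<lambda>(x, z). \<rho> * x + z) = gauss 1"
    using distr_gauss_pair_affine[of 1 v \<rho>] v by simp
  show ?thesis
    unfolding bivariate_std_normal_shear[OF assms] v_def[symmetric]
    by (subst distr_distr) (use * in \<open>auto simp: comp_def split_beta'\<close>)
qed

text \<open>
  The quadrants are an intersection-stable generator of the Borel sets of the plane. Sklar's relation
  speaks about quadrants only, so this is what turns it into a statement about laws.
\<close>

lemma measure_pair_eqI_atMost:
  fixes P Q :: "(real \<times> real) measure"
  assumes "prob_space P" "prob_space Q"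
    and sets: "sets P = sets (borel \<Otimes>\<^sub>M borel)" "sets Q = sets (borel \<Otimes>\<^sub>M borel)"
    and eq: "\<And>x z. measure P ({..x} \<times> {..z}) = measure Q ({..x} \<times> {..z})"
  shows "P = Q"
proof -
  interpret P: prob_space P by fact
  interpret Q: prob_space Q by fact
  have T: "{..(x, z)} = {..x} \<times> {..z}" for x z :: real
    by (auto simp: less_eq_prod_def)
  let ?E = "range (\<lambda>a::real \<times> real. {..a})"
  have borel: "sets (borel \<Otimes>\<^sub>M borel) = sigma_sets UNIV ?E"
    unfolding borel_prod by (subst borel_eq_atMost) simp
  show ?thesis
  proof (rule measure_eqI_generator_eq[where \<Omega> = UNIV and E = ?E and A = "\<lambda>n. {..(real n, real n)}"])
    show "Int_stable ?E"
    proof (rule Int_stableI)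
      fix A B assume "A \<in> ?E" "B \<in> ?E"
      then obtain a b where "A = {..a}" "B = {..b}" by auto
      then have "A \<inter> B = {..inf a b}" by auto
      then show "A \<inter> B \<in> ?E" by simp
    qed
    show "(\<Union>i. {..(real i, real i)}) = (UNIV :: (real \<times> real) set)"
    proof safe
      fix a b :: real
      obtain n where "max a b \<le> real n" using real_arch_simple by blast
      then show "(a, b) \<in> (\<Union>i. {..(real i, real i)})" by (auto simp: less_eq_prod_def)
    qed simp
    show "emeasure P X = emeasure Q X" if "X \<in> ?E" for X
      using that eq by (auto simp: T P.emeasure_eq_measure Q.emeasure_eq_measure)
  qed (auto simp: sets borel)
qed

text \<open>
  The distribution function of a centred normal law with standard deviation \<open>s\<close> at \<open>x\<close> is the
  standard one at \<open>x / s\<close>. So the copula relation for \<open>(X, Z)\<close> at \<open>(x, z)\<close> and the copula relation for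
  the standard bivariate normal pair at \<open>(x / s, z / \<sigma>)\<close> evaluate \<open>C\<close> at the same point, and
  \<open>(X, Z)\<close> has the law of the rescaled standard pair.
\<close>

lemma gaussian_copula_joint_law:
  assumes M: "prob_space M" and r: "\<bar>\<rho>\<bar> < 1" and s: "0 < s" and \<sigma>: "0 < \<sigma>"
    and [measurable]: "X \<in> borel_measurable M" "Z \<in> borel_measurable M"
    and X: "distr M borel X = gauss s" and Z: "distr M borel Z = gauss \<sigma>"
    and G: "is_gaussian_copula \<rho> C" and C: "has_copula M X Z C"
  shows "distr M (borel \<Otimes>\<^sub>M borel) (\<lambda>\<omega>. (X \<omega>, Z \<omega>)) =
    distr (gauss s \<Otimes>\<^sub>M gauss (\<sigma> * sqrt (1 - \<rho>\<^sup>2))) (borel \<Otimes>\<^sub>M borel)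
      (\<lambda>(x, e). (x, \<rho> * \<sigma> / s * x + e))"
proof -
  define v where "v = sqrt (1 - \<rho>\<^sup>2)"
  have v: "v > 0" using r by (simp add: v_def abs_square_less_1)
  interpret prob_space M by fact
  interpret G1: prob_space "gauss 1" by (rule prob_space_gauss) simp
  interpret V: prob_space "gauss v" by (rule prob_space_gauss) fact
  interpret P: pair_prob_space "gauss 1" "gauss v" ..
  let ?B = "bivariate_std_normal \<rho>"
  have B: "?B = distr (gauss 1 \<Otimes>\<^sub>M gauss v) (borel \<Otimes>\<^sub>M borel) (\<lambda>(x, z). (x, \<rho> * x + z))"
    unfolding v_def by (rule bivariate_std_normal_shear) fact
  have sB[measurable_cong, simp]: "sets ?B = sets (borel \<Otimes>\<^sub>M borel)" by (simp add: B)
  have spB[simp]: "space ?B = UNIV" by (simp add: B space_pair_measure)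
  have pB: "prob_space ?B" unfolding B by (rule P.prob_space_distr) measurable
  interpret B: prob_space ?B by fact
  have cdf: "cdf (gauss c) x = cdf (gauss 1) (x / c)" if "0 < c" for c x
  proof -
    have "cdf (distr (gauss 1) borel (\<lambda>x. c * x)) x = cdf (gauss 1) (x / c)"
      unfolding cdf_def using that
      by (subst measure_distr) (auto intro!: arg_cong[where f="measure (gauss 1)"] simp: field_simps)
    then show ?thesis using distr_gauss_scale[of 1 c] that by simp
  qed
  have "distr M (borel \<Otimes>\<^sub>M borel) (\<lambda>\<omega>. (X \<omega>, Z \<omega>)) =
     distr ?B (borel \<Otimes>\<^sub>M borel) (\<lambda>(x, z). (s * x, \<sigma> * z))"
  proof (rule measure_pair_eqI_atMost)
    show "prob_space (distr M (borel \<Otimes>\<^sub>M borel) (\<lambda>\<omega>. (X \<omega>, Z \<omega>)))"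
      by (rule prob_space_distr) measurable
    show "prob_space (distr ?B (borel \<Otimes>\<^sub>M borel) (\<lambda>(x, z). (s * x, \<sigma> * z)))"
      by (rule B.prob_space_distr) measurable
    fix x z
    have "measure (distr M (borel \<Otimes>\<^sub>M borel) (\<lambda>\<omega>. (X \<omega>, Z \<omega>))) ({..x} \<times> {..z}) =
       measure M {\<omega> \<in> space M. X \<omega> \<le> x \<and> Z \<omega> \<le> z}"
      by (subst measure_distr) (auto intro!: arg_cong[where f="measure M"])
    also have "\<dots> = C (cdf (gauss s) x) (cdf (gauss \<sigma>) z)"
      using C unfolding has_copula_def X Z by auto
    also have "\<dots> = C (cdf (gauss 1) (x / s)) (cdf (gauss 1) (z / \<sigma>))"
      by (simp add: cdf[OF s, of x] cdf[OF \<sigma>, of z])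
    also have "\<dots> = measure ?B {\<omega> \<in> space ?B. fst \<omega> \<le> x / s \<and> snd \<omega> \<le> z / \<sigma>}"
      using G unfolding is_gaussian_copula_def has_copula_def
        distr_fst_bivariate_std_normal[OF r] distr_snd_bivariate_std_normal[OF r] by auto
    also have "\<dots> = measure (distr ?B (borel \<Otimes>\<^sub>M borel) (\<lambda>(x, z). (s * x, \<sigma> * z))) ({..x} \<times> {..z})"
      by (subst measure_distr)
         (use s \<sigma> in \<open>auto intro!: arg_cong[where f="measure ?B"] simp: field_simps\<close>)
    finally show "measure (distr M (borel \<Otimes>\<^sub>M borel) (\<lambda>\<omega>. (X \<omega>, Z \<omega>))) ({..x} \<times> {..z}) =
      measure (distr ?B (borel \<Otimes>\<^sub>M borel) (\<lambda>(x, z). (s * x, \<sigma> * z))) ({..x} \<times> {..z})" .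
  qed simp_all
  also have "\<dots> = distr (gauss 1 \<Otimes>\<^sub>M gauss v) (borel \<Otimes>\<^sub>M borel) (\<lambda>(x, z). (s * x, \<sigma> * (\<rho> * x + z)))"
    unfolding B by (subst distr_distr) (auto simp: comp_def split_beta')
  also have "\<dots> = distr (distr (gauss 1) borel (\<lambda>x. s * x) \<Otimes>\<^sub>M distr (gauss v) borel (\<lambda>z. \<sigma> * z))
     (borel \<Otimes>\<^sub>M borel) (\<lambda>(x, e). (x, \<rho> * \<sigma> / s * x + e))"
  proof (subst pair_measure_distr)
    show "sigma_finite_measure (distr (gauss v) borel ((*) \<sigma>))"
      using distr_gauss_scale[OF v \<sigma>] prob_space_gauss[of "\<sigma> * v"] v \<sigma>
        prob_space_imp_sigma_finite by simp
    show "distr (gauss 1 \<Otimes>\<^sub>M gauss v) (borel \<Otimes>\<^sub>M borel) (\<lambda>(x, z). (s * x, \<sigma> * (\<rho> * x + z))) =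
      distr (distr (gauss 1 \<Otimes>\<^sub>M gauss v) (borel \<Otimes>\<^sub>M borel) (\<lambda>(x, y). (s * x, \<sigma> * y)))
       (borel \<Otimes>\<^sub>M borel) (\<lambda>(x, e). (x, \<rho> * \<sigma> / s * x + e))"
      using s by (subst distr_distr) (auto simp: comp_def split_beta' algebra_simps)
  qed measurable
  finally show ?thesis
    using distr_gauss_scale[OF v \<sigma>] distr_gauss_scale[of 1 s] s by (simp add: v_def)
qed

section \<open>Smoothing by a Gaussian\<close>

lemma integral_gauss:
  assumes [measurable]: "f \<in> borel_measurable borel"
  shows "(\<integral>e. f e \<partial>gauss v) = (\<integral>e. normal_density 0 v e * f e \<partial>lborel)"
  unfolding gauss_def by (subst integral_real_density) auto

lemma integrable_gauss_bounded:
  assumes v: "0 < v" and [measurable]: "f \<in> borel_measurable borel"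
    and f: "\<And>x. f x \<in> {0..1::real}"
  shows "integrable (gauss v) f"
proof -
  interpret prob_space "gauss v" by (rule prob_space_gauss) fact
  show ?thesis
    by (rule integrable_const_bound[where B=1]) (use f in auto)
qed

text \<open>
  Substitution moves the shift from \<open>h\<close> to the density \<open>p\<close>, and it remains to bound
  \<open>p(e) - p(e + \<delta>)\<close> from above. Since \<open>1 - exp(-u) \<le> u\<close>, it is at most \<open>p(e)\<close> times the
  logarithm of \<open>p(e) / p(e + \<delta>)\<close>, which is linear in \<open>e\<close>; so only the first absolute moment of \<open>p\<close>
  enters.
\<close>

lemma gauss_smoothing_diff_le:
  fixes h :: "real \<Rightarrow> real"
  assumes v: "0 < v" and h[measurable]: "h \<in> borel_measurable borel" and h01: "\<And>x. h x \<in> {0..1}"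
  shows "(\<integral>e. h (x + e) \<partial>gauss v) - (\<integral>e. h (y + e) \<partial>gauss v) \<le> \<bar>x - y\<bar> / v + (\<bar>x - y\<bar> / v)\<^sup>2 / 2"
proof -
  define \<delta> where "\<delta> = x - y"
  let ?p = "normal_density 0 v"
  have int: "integrable lborel (\<lambda>e. ?p e * h (z + e))" for z
  proof -
    have "integrable (gauss v) (\<lambda>e. h (z + e))"
      using h01 by (intro integrable_gauss_bounded[OF v]) auto
    then show ?thesis
      unfolding gauss_def by (subst (asm) integrable_real_density) auto
  qed
  have int': "integrable lborel (\<lambda>e. ?p (e + \<delta>) * h (x + e))"
    using lborel_integrable_real_affine[OF int[of y], of 1 \<delta>]
    by (simp add: \<delta>_def algebra_simps)
  \<comment> \<open>The substitution \<open>e \<mapsto> e + \<delta>\<close> uses \<open>y + \<delta> = x\<close>.\<close>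
  have shift: "(\<integral>e. ?p e * h (y + e) \<partial>lborel) = (\<integral>e. ?p (e + \<delta>) * h (x + e) \<partial>lborel)"
    by (subst lborel_integral_real_affine[where c=1 and t=\<delta>]) (auto simp: \<delta>_def algebra_simps)
  let ?b = "\<lambda>e. (\<bar>e\<bar> * \<bar>\<delta>\<bar> + \<delta>\<^sup>2 / 2) / v\<^sup>2"
  have pt: "?p e * h (x + e) - ?p (e + \<delta>) * h (x + e) \<le> ?p e * ?b e" for e
  proof -
    have "?p (e + \<delta>) = ?p e * exp (- ((e * \<delta> + \<delta>\<^sup>2 / 2) / v\<^sup>2))"
    proof -
      have "- (e + \<delta> - 0)\<^sup>2 / (2 * v\<^sup>2) = - (e - 0)\<^sup>2 / (2 * v\<^sup>2) + - ((e * \<delta> + \<delta>\<^sup>2 / 2) / v\<^sup>2)"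
        using v by (simp add: field_simps power2_eq_square)
      then show ?thesis unfolding normal_density_def by (simp only: exp_add mult.assoc)
    qed
    also have "\<dots> \<ge> ?p e * (1 + - ((e * \<delta> + \<delta>\<^sup>2 / 2) / v\<^sup>2))"
      by (intro mult_left_mono exp_ge_add_one_self) simp
    finally have 1: "?p e - ?p (e + \<delta>) \<le> ?p e * ((e * \<delta> + \<delta>\<^sup>2 / 2) / v\<^sup>2)"
      by (simp add: algebra_simps)
    have "e * \<delta> \<le> \<bar>e\<bar> * \<bar>\<delta>\<bar>"
      using abs_ge_self[of "e * \<delta>"] by (simp add: abs_mult)
    then have "(e * \<delta> + \<delta>\<^sup>2 / 2) / v\<^sup>2 \<le> ?b e"
      by (intro divide_right_mono) auto
    then have "?p e * ((e * \<delta> + \<delta>\<^sup>2 / 2) / v\<^sup>2) \<le> ?p e * ?b e"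
      by (rule mult_left_mono) simp
    with 1 have 2: "?p e - ?p (e + \<delta>) \<le> ?p e * ?b e" by simp
    have "(?p e - ?p (e + \<delta>)) * h (x + e) \<le> ?p e * ?b e * h (x + e)"
      using 2 h01[of "x + e"] by (intro mult_right_mono) auto
    also have "\<dots> \<le> ?p e * ?b e * 1"
      using h01[of "x + e"] v by (intro mult_left_mono) auto
    finally show ?thesis by (simp add: algebra_simps)
  qed
  let ?I = "(v * sqrt (2 / pi) * \<bar>\<delta>\<bar> + \<delta>\<^sup>2 / 2) / v\<^sup>2"
  have b: "has_bochner_integral lborel (\<lambda>e. ?p e * ?b e) ?I"
  proof -
    have "has_bochner_integral lborel (\<lambda>e. ?p e * \<bar>e\<bar>) (v * sqrt (2 / pi))"
      using normal_moment_abs_odd[OF v, of 0 0] by simp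
    moreover have "has_bochner_integral lborel ?p 1"
      using v by (simp add: has_bochner_integral_iff)
    ultimately have "has_bochner_integral lborel
      (\<lambda>e. (?p e * \<bar>e\<bar> * \<bar>\<delta>\<bar> + ?p e * (\<delta>\<^sup>2 / 2)) / v\<^sup>2)
      ((v * sqrt (2 / pi) * \<bar>\<delta>\<bar> + 1 * (\<delta>\<^sup>2 / 2)) / v\<^sup>2)"
      using v by (intro has_bochner_integral_add has_bochner_integral_mult_left
          has_bochner_integral_divide) auto
    moreover have "(\<lambda>e. (?p e * \<bar>e\<bar> * \<bar>\<delta>\<bar> + ?p e * (\<delta>\<^sup>2 / 2)) / v\<^sup>2) = (\<lambda>e. ?p e * ?b e)"
      by (auto simp: distrib_left mult.assoc)
    ultimately show ?thesis by simp
  qed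
  have "(\<integral>e. h (x + e) \<partial>gauss v) - (\<integral>e. h (y + e) \<partial>gauss v) =
    (\<integral>e. ?p e * h (x + e) - ?p (e + \<delta>) * h (x + e) \<partial>lborel)"
    by (simp add: integral_gauss shift Bochner_Integration.integral_diff[OF int int'])
  also have "\<dots> \<le> (\<integral>e. ?p e * ?b e \<partial>lborel)"
    using b int int' pt by (intro integral_mono) (auto simp: has_bochner_integral_iff)
  also have "\<dots> = ?I"
    using b by (simp add: has_bochner_integral_iff)
  also have "\<dots> \<le> (v * 1 * \<bar>\<delta>\<bar> + \<delta>\<^sup>2 / 2) / v\<^sup>2"
    using v pi_ge_two by (intro divide_right_mono add_mono mult_right_mono mult_left_mono) auto
  also have "\<dots> = \<bar>x - y\<bar> / v + (\<bar>x - y\<bar> / v)\<^sup>2 / 2"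
    using v by (simp add: \<delta>_def field_simps power2_eq_square)
  finally show ?thesis .
qed

lemma integral_gauss_in_unit:
  assumes v: "0 < v" and h[measurable]: "h \<in> borel_measurable borel" and h01: "\<And>x. h x \<in> {0..1::real}"
  shows "(\<integral>e. h (x + e) \<partial>gauss v) \<in> {0..1}"
proof -
  interpret prob_space "gauss v" by (rule prob_space_gauss) fact
  have "(\<integral>e. h (x + e) \<partial>gauss v) \<le> (\<integral>e. 1 \<partial>gauss v)"
    using h01 by (intro integral_mono integrable_gauss_bounded[OF v]) auto
  moreover have "(\<integral>e. h (x + e) \<partial>gauss v) \<ge> 0"
    using h01 by (intro integral_nonneg_AE) auto
  ultimately show ?thesis using prob_space by simp
qed

text \<open>
  The bound \<open>d + d\<^sup>2/2\<close> with \<open>d = \<bar>x - y\<bar> / v\<close> is at most \<open>2d\<close> for \<open>d \<le> 1\<close>, and for larger \<open>d\<close>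
  the difference is at most 1 anyway.
\<close>

lemma gauss_smoothing_lipschitz:
  fixes h :: "real \<Rightarrow> real"
  assumes v: "0 < v" and h[measurable]: "h \<in> borel_measurable borel" and h01: "\<And>x. h x \<in> {0..1}"
  shows "\<bar>(\<integral>e. h (x + e) \<partial>gauss v) - (\<integral>e. h (y + e) \<partial>gauss v)\<bar> \<le> 2 / v * \<bar>x - y\<bar>"
proof -
  define d where "d = \<bar>x - y\<bar> / v"
  have d: "d \<ge> 0" using v by (simp add: d_def)
  let ?I = "\<lambda>x. \<integral>e. h (x + e) \<partial>gauss v"
  have "\<bar>?I x - ?I y\<bar> \<le> d + d\<^sup>2 / 2"
    using gauss_smoothing_diff_le[OF assms, of x y] gauss_smoothing_diff_le[OF assms, of y x]
    unfolding abs_minus_commute[of y x] d_def[symmetric] by linarith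
  moreover have "\<bar>?I x - ?I y\<bar> \<le> 1"
    using integral_gauss_in_unit[OF assms, of x] integral_gauss_in_unit[OF assms, of y] by auto
  moreover have "d\<^sup>2 \<le> d" if "d \<le> 1"
    using that d by (simp add: power2_eq_square mult_left_le)
  ultimately have "\<bar>?I x - ?I y\<bar> \<le> 2 * d" using d by linarith
  then show ?thesis by (simp add: d_def)
qed

section \<open>From the Markov property to a Gaussian transition kernel\<close>

lemma space_generated_sigma [simp]: "space (generated_sigma M Y S) = space M"
  unfolding generated_sigma_def by (rule space_measure_of) auto

lemma sets_generated_sigma:
  "sets (generated_sigma M Y S) =
     sigma_sets (space M) (\<Union>s\<in>S. {Y s -` A \<inter> space M | A. A \<in> sets borel})"
  unfolding generated_sigma_def by (rule sets_measure_of) auto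

lemma sets_generated_sigma_mono:
  "S \<subseteq> T \<Longrightarrow> sets (generated_sigma M Y S) \<subseteq> sets (generated_sigma M Y T)"
  unfolding sets_generated_sigma by (intro sigma_sets_mono') blast

lemma sets_generated_sigma_subset:
  assumes "\<And>s. s \<in> S \<Longrightarrow> Y s \<in> borel_measurable M"
  shows "sets (generated_sigma M Y S) \<subseteq> sets M"
  unfolding sets_generated_sigma
  by (rule sets.sigma_sets_subset) (auto intro: measurable_sets[OF assms])

lemma measurable_generated_sigma:
  assumes "s \<in> S"
  shows "Y s \<in> borel_measurable (generated_sigma M Y S)"
  by (rule measurableI) (use assms in \<open>auto simp: sets_generated_sigma intro!: sigma_sets.Basic\<close>)

lemma (in prob_space) nn_integral_eq_integral_unit:
  assumes "f \<in> borel_measurable M" "\<And>x. x \<in> space M \<Longrightarrow> f x \<in> {0..1::real}"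
  shows "(\<integral>\<^sup>+x. ennreal (f x) \<partial>M) = ennreal (\<integral>x. f x \<partial>M)"
proof (rule nn_integral_eq_integral)
  show "integrable M f"
    by (rule integrable_const_bound[where B=1]) (use assms in auto)
  show "AE x in M. 0 \<le> f x" by (rule AE_I2) (use assms in auto)
qed

lemma borel_measurable_integral_gauss_shift [measurable]:
  assumes v: "0 < v" and [measurable]: "h \<in> borel_measurable borel"
  shows "(\<lambda>y. \<integral>e. (h (a * y + e) :: real) \<partial>gauss v) \<in> borel_measurable borel"
proof -
  interpret prob_space "gauss v" by (rule prob_space_gauss) fact
  show ?thesis by measurable
qed

text \<open>
  The joint law identifies the conditional probability of \<open>{Z \<in> C}\<close> given \<open>X\<close> as the mass of \<open>C\<close>
  under the normal law centred at \<open>c X\<close>, and the Markov hypothesis \<open>cond\<close> allows the larger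
  \<open>\<sigma>\<close>-algebra \<open>F\<close> in its place. This proves the formula for indicators; comparing, for fixed
  \<open>A\<close>, the two measures \<open>\<mu>\<close> and \<open>\<nu>\<close> on the line carries it over to every \<open>Q\<close>.
\<close>

lemma (in prob_space) one_step_kernel:
  fixes X Z :: "'a \<Rightarrow> real" and Q :: "real \<Rightarrow> real"
  assumes v: "0 < v" and [measurable]: "X \<in> borel_measurable M" "Z \<in> borel_measurable M"
    and subF: "subalgebra M F"
    and XF: "X \<in> borel_measurable F"
    and joint: "distr M (borel \<Otimes>\<^sub>M borel) (\<lambda>\<omega>. (X \<omega>, Z \<omega>)) =
      distr (distr M borel X \<Otimes>\<^sub>M gauss v) (borel \<Otimes>\<^sub>M borel) (\<lambda>(x, e). (x, c * x + e))"
    and cond: "\<And>C. C \<in> sets borel \<Longrightarrow> AE \<omega> in M.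
       real_cond_exp M F (indicator (Z -` C \<inter> space M)) \<omega> =
       real_cond_exp M (vimage_algebra (space M) X borel) (indicator (Z -` C \<inter> space M)) \<omega>"
    and A: "A \<in> sets F"
    and Q[measurable]: "Q \<in> borel_measurable borel" and Q01: "\<And>x. Q x \<in> {0..1}"
  shows "(\<integral>\<omega>. indicator A \<omega> * Q (Z \<omega>) \<partial>M) =
     (\<integral>\<omega>. indicator A \<omega> * (\<integral>e. Q (c * X \<omega> + e) \<partial>gauss v) \<partial>M)"
proof -
  interpret G: prob_space "gauss v" by (rule prob_space_gauss) fact
  interpret X: prob_space "distr M borel X" by (rule prob_space_distr) measurable
  interpret P: pair_prob_space "distr M borel X" "gauss v" ..
  let ?S = "vimage_algebra (space M) X borel"
  have subS: "subalgebra M ?S"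
    by (auto simp: subalgebra_def sets_vimage_algebra2)
  interpret F: finite_measure_subalgebra M F by standard fact
  interpret S: finite_measure_subalgebra M ?S by standard fact
  have AM[measurable]: "A \<in> sets M" using A subF by (auto simp: subalgebra_def)
  have indic: "(\<integral>\<omega>. indicator A \<omega> * indicator C (Z \<omega>) \<partial>M :: real) =
     (\<integral>\<omega>. indicator A \<omega> * (\<integral>e. indicator C (c * X \<omega> + e) \<partial>gauss v) \<partial>M)"
    if C[measurable]: "C \<in> sets borel" for C
  proof -
    define k where "k x = (\<integral>e. indicator C (c * x + e) \<partial>gauss v :: real)" for x
    have k[measurable]: "k \<in> borel_measurable borel"
      unfolding k_def by (rule borel_measurable_integral_gauss_shift[OF v]) measurable
    have k01: "k x \<in> {0..1}" for x
      unfolding k_def by (rule integral_gauss_in_unit[OF v]) auto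
    let ?f = "indicator (Z -` C \<inter> space M) :: 'a \<Rightarrow> real"
    have intf: "integrable M ?f"
      by (rule integrable_const_bound[where B=1]) auto
    have intk: "integrable M (\<lambda>\<omega>. k (X \<omega>))"
      by (rule integrable_const_bound[where B=1]) (use k01 in auto)
    have "AE \<omega> in M. real_cond_exp M ?S ?f \<omega> = k (X \<omega>)"
    proof (rule S.real_cond_exp_charact[OF _ intf intk])
      show "(\<lambda>\<omega>. k (X \<omega>)) \<in> borel_measurable ?S"
        by (rule measurable_compose[OF measurable_vimage_algebra1 k]) auto
      fix D assume "D \<in> sets ?S"
      then obtain B where D: "D = X -` B \<inter> space M" and B[measurable]: "B \<in> sets borel"
        by (auto simp: sets_vimage_algebra2)
      have "(\<integral>\<omega>\<in>D. ?f \<omega> \<partial>M) = (\<integral>\<omega>. indicator (B \<times> C) (X \<omega>, Z \<omega>) \<partial>M)"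
        unfolding set_lebesgue_integral_def
        by (rule Bochner_Integration.integral_cong) (auto simp: D indicator_def)
      also have "\<dots> = (\<integral>p. indicator (B \<times> C) p \<partial>distr M (borel \<Otimes>\<^sub>M borel) (\<lambda>\<omega>. (X \<omega>, Z \<omega>)))"
        by (subst integral_distr) auto
      also have "\<dots> = (\<integral>(x, e). indicator (B \<times> C) (x, c * x + e) \<partial>(distr M borel X \<Otimes>\<^sub>M gauss v))"
        unfolding joint by (subst integral_distr) (auto simp: split_beta')
      also have "\<dots> = (\<integral>x. (\<integral>e. indicator (B \<times> C) (x, c * x + e) \<partial>gauss v) \<partial>distr M borel X)"
        by (subst P.integral_fst'[symmetric])
           (auto simp: split_beta' intro!: P.integrable_const_bound[where B=1] split: split_indicator)
      also have "\<dots> = (\<integral>x. indicator B x * k x \<partial>distr M borel X)"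
        by (rule Bochner_Integration.integral_cong) (auto simp: k_def indicator_times)
      also have "\<dots> = (\<integral>\<omega>. indicator B (X \<omega>) * k (X \<omega>) \<partial>M)"
        by (subst integral_distr) auto
      also have "\<dots> = (\<integral>\<omega>\<in>D. k (X \<omega>) \<partial>M)"
        unfolding set_lebesgue_integral_def
        by (rule Bochner_Integration.integral_cong) (auto simp: D indicator_def)
      finally show "(\<integral>\<omega>\<in>D. ?f \<omega> \<partial>M) = (\<integral>\<omega>\<in>D. k (X \<omega>) \<partial>M)" .
    qed
    with cond[OF C] have ae: "AE \<omega> in M. real_cond_exp M F ?f \<omega> = k (X \<omega>)" by auto
    have "(\<integral>\<omega>. indicator A \<omega> * indicator C (Z \<omega>) \<partial>M :: real) = (\<integral>\<omega>\<in>A. ?f \<omega> \<partial>M)"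
      unfolding set_lebesgue_integral_def
      by (rule Bochner_Integration.integral_cong) (auto simp: indicator_def)
    also have "\<dots> = (\<integral>\<omega>\<in>A. real_cond_exp M F ?f \<omega> \<partial>M)"
      by (rule F.real_cond_exp_intA[OF intf A])
    also have "\<dots> = (\<integral>\<omega>\<in>A. k (X \<omega>) \<partial>M)"
      unfolding set_lebesgue_integral_def
      by (rule integral_cong_AE) (use ae in auto)
    finally show ?thesis by (simp add: set_lebesgue_integral_def k_def)
  qed
  define \<mu> where "\<mu> = distr (density M (indicator A)) borel Z"
  define \<nu> where "\<nu> = distr (distr (density M (indicator A)) borel X \<Otimes>\<^sub>M gauss v) borel (\<lambda>(x, e). c * x + e)"
  have int_\<mu>: "(\<integral>\<^sup>+z. q z \<partial>\<mu>) = (\<integral>\<^sup>+\<omega>. indicator A \<omega> * q (Z \<omega>) \<partial>M)"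
    if [measurable]: "q \<in> borel_measurable borel" for q :: "real \<Rightarrow> ennreal"
    unfolding \<mu>_def by (simp add: nn_integral_distr nn_integral_density)
  have int_\<nu>: "(\<integral>\<^sup>+z. q z \<partial>\<nu>) = (\<integral>\<^sup>+\<omega>. indicator A \<omega> * (\<integral>\<^sup>+e. q (c * X \<omega> + e) \<partial>gauss v) \<partial>M)"
    if [measurable]: "q \<in> borel_measurable borel" for q :: "real \<Rightarrow> ennreal"
    unfolding \<nu>_def
    by (simp add: nn_integral_distr nn_integral_density split_beta' G.nn_integral_fst[symmetric])
  have nn_\<mu>: "(\<integral>\<^sup>+z. ennreal (q z) \<partial>\<mu>) = ennreal (\<integral>\<omega>. indicator A \<omega> * q (Z \<omega>) \<partial>M)"
    if [measurable]: "q \<in> borel_measurable borel" and q: "\<And>x. q x \<in> {0..1}" for q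
  proof -
    have "(\<integral>\<^sup>+z. ennreal (q z) \<partial>\<mu>) = (\<integral>\<^sup>+\<omega>. ennreal (indicator A \<omega> * q (Z \<omega>)) \<partial>M)"
      by (subst int_\<mu>) (auto intro!: nn_integral_cong split: split_indicator)
    also have "\<dots> = ennreal (\<integral>\<omega>. indicator A \<omega> * q (Z \<omega>) \<partial>M)"
      by (rule nn_integral_eq_integral_unit) (use q in \<open>auto split: split_indicator\<close>)
    finally show ?thesis .
  qed
  have nn_\<nu>: "(\<integral>\<^sup>+z. ennreal (q z) \<partial>\<nu>) =
      ennreal (\<integral>\<omega>. indicator A \<omega> * (\<integral>e. q (c * X \<omega> + e) \<partial>gauss v) \<partial>M)"
    if [measurable]: "q \<in> borel_measurable borel" and q: "\<And>x. q x \<in> {0..1}" for q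
  proof -
    define k where "k x = (\<integral>e. q (c * x + e) \<partial>gauss v)" for x
    have [measurable]: "k \<in> borel_measurable borel"
      unfolding k_def by (rule borel_measurable_integral_gauss_shift[OF v]) measurable
    have k01: "k x \<in> {0..1}" for x
      unfolding k_def by (rule integral_gauss_in_unit[OF v]) (use q in auto)
    have "(\<integral>\<^sup>+e. ennreal (q (c * x + e)) \<partial>gauss v) = ennreal (k x)" for x
      unfolding k_def by (rule G.nn_integral_eq_integral_unit) (use q in auto)
    then have "(\<integral>\<^sup>+z. ennreal (q z) \<partial>\<nu>) = (\<integral>\<^sup>+\<omega>. ennreal (indicator A \<omega> * k (X \<omega>)) \<partial>M)"
      by (subst int_\<nu>) (auto intro!: nn_integral_cong split: split_indicator)
    also have "\<dots> = ennreal (\<integral>\<omega>. indicator A \<omega> * k (X \<omega>) \<partial>M)"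
      by (rule nn_integral_eq_integral_unit) (use k01 in \<open>auto split: split_indicator\<close>)
    finally show ?thesis by (simp add: k_def)
  qed
  have "\<mu> = \<nu>"
  proof (rule measure_eqI)
    show "sets \<mu> = sets \<nu>" by (simp add: \<mu>_def \<nu>_def)
    fix C assume "C \<in> sets \<mu>"
    then have C[measurable]: "C \<in> sets borel" "C \<in> sets \<mu>" "C \<in> sets \<nu>" by (auto simp: \<mu>_def \<nu>_def)
    have "(\<integral>\<^sup>+z. ennreal (indicator C z) \<partial>\<mu>) = (\<integral>\<^sup>+z. ennreal (indicator C z) \<partial>\<nu>)"
      by (subst nn_\<mu>, simp, simp, subst nn_\<nu>, simp, simp, subst indic, simp, simp)
    then show "emeasure \<mu> C = emeasure \<nu> C" using C by (simp add: ennreal_indicator)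
  qed
  then have "ennreal (\<integral>\<omega>. indicator A \<omega> * Q (Z \<omega>) \<partial>M) =
    ennreal (\<integral>\<omega>. indicator A \<omega> * (\<integral>e. Q (c * X \<omega> + e) \<partial>gauss v) \<partial>M)"
    using nn_\<mu>[OF Q Q01] nn_\<nu>[OF Q Q01] by simp
  moreover have "0 \<le> (\<integral>e. Q (c * X \<omega> + e) \<partial>gauss v)" for \<omega>
    using integral_gauss_in_unit[OF v Q Q01] by simp
  ultimately show ?thesis
    using Q01 by (subst (asm) ennreal_inj) (auto intro!: integral_nonneg_AE)
qed

section \<open>Chains with linear Gaussian transitions\<close>

text \<open>
  The transition assumption says that \<open>Y (Suc t)\<close>, given the past up to time \<open>t\<close>, is normal with mean
  \<open>a t * Y t\<close> and standard deviation \<open>v\<close>. Time 0 is left out: the Gaussian convolution process leaves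
  its constant start with the full innovation variance, which exceeds \<open>v\<^sup>2\<close>.
\<close>

locale linear_gaussian_chain = prob_space M
  for M :: "'a measure" and Y :: "nat \<Rightarrow> 'a \<Rightarrow> real" and a :: "nat \<Rightarrow> real" and v :: real +
  assumes v_pos: "0 < v"
    and Y_measurable [measurable]: "Y t \<in> borel_measurable M"
    and transition: "\<lbrakk>1 \<le> t; A \<in> sets (generated_sigma M Y {0..t}); Q \<in> borel_measurable borel;
      \<And>x. Q x \<in> {0..1::real}\<rbrakk> \<Longrightarrow>
      (\<integral>\<omega>. indicator A \<omega> * Q (Y (Suc t) \<omega>) \<partial>M) =
      (\<integral>\<omega>. indicator A \<omega> * (\<integral>e. Q (a t * Y t \<omega> + e) \<partial>gauss v) \<partial>M)"

text \<open>
  The covariances of \<open>A\<close> with the cells of a partition add up to 0, so the positive ones carry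
  half of the sum of absolute values; by additivity they combine to the covariance of \<open>A\<close> with the
  union of their cells.
\<close>

lemma (in prob_space) sum_abs_covariance_partition:
  assumes Q: "finite Q" "partition_on (space M) Q" "Q \<subseteq> sets M" and A: "A \<in> sets M"
  shows "(\<Sum>B\<in>Q. \<bar>prob (A \<inter> B) - prob A * prob B\<bar>) =
    2 * (prob (A \<inter> \<Union>{B \<in> Q. 0 \<le> prob (A \<inter> B) - prob A * prob B}) -
      prob A * prob (\<Union>{B \<in> Q. 0 \<le> prob (A \<inter> B) - prob A * prob B}))"
proof -
  let ?x = "\<lambda>B. prob (A \<inter> B) - prob A * prob B"
  have disj: "disjoint Q" using Q(2) by (auto simp: partition_on_def)
  have sum: "(\<Sum>B\<in>R. ?x B) = prob (A \<inter> \<Union>R) - prob A * prob (\<Union>R)" if R: "R \<subseteq> Q" for R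
  proof -
    have fin: "finite R" using R Q(1) finite_subset by blast
    have dj: "disjoint_family_on (\<lambda>B. B) R"
      using disj R by (auto simp: disjoint_family_on_def disjoint_def)
    then have dj': "disjoint_family_on (\<lambda>B. A \<inter> B) R"
      by (auto simp: disjoint_family_on_def)
    have "prob (\<Union>B\<in>R. B) = (\<Sum>B\<in>R. prob B)"
      by (rule finite_measure_finite_Union[OF fin _ dj]) (use R Q(3) in auto)
    moreover have "prob (\<Union>B\<in>R. A \<inter> B) = (\<Sum>B\<in>R. prob (A \<inter> B))"
      by (rule finite_measure_finite_Union[OF fin _ dj']) (use R Q(3) A in auto)
    moreover have "(\<Union>B\<in>R. A \<inter> B) = A \<inter> \<Union>R" by auto
    ultimately show ?thesis by (simp add: sum_subtractf sum_distrib_left)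
  qed
  have "\<Union>Q = space M" using Q(2) by (auto simp: partition_on_def)
  then have total: "(\<Sum>B\<in>Q. ?x B) = 0"
    using sum[of Q] sets.sets_into_space[OF A] prob_space by (simp add: Int_absorb2)
  have "(\<Sum>B\<in>Q. \<bar>?x B\<bar>) = (\<Sum>B\<in>Q. 2 * (if 0 \<le> ?x B then ?x B else 0) - ?x B)"
    by (rule sum.cong) auto
  also have "\<dots> = 2 * (\<Sum>B\<in>Q. if 0 \<le> ?x B then ?x B else 0)"
    using total by (simp add: sum_subtractf sum_distrib_left)
  also have "(\<Sum>B\<in>Q. if 0 \<le> ?x B then ?x B else 0) = (\<Sum>B\<in>{B \<in> Q. 0 \<le> ?x B}. ?x B)"
    using Q(1) by (simp add: sum.inter_filter)
  finally show ?thesis by (simp add: sum)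
qed

context linear_gaussian_chain
begin

abbreviation past :: "nat \<Rightarrow> 'a measure" where "past n \<equiv> generated_sigma M Y {0..n}"
abbreviation future :: "nat \<Rightarrow> 'a measure" where "future n \<equiv> generated_sigma M Y {n..}"

lemma sets_generated_sigma_events: "A \<in> sets (generated_sigma M Y S) \<Longrightarrow> A \<in> sets M"
  using sets_generated_sigma_subset[of S Y M] by auto

lemma past_preimage:
  assumes "B \<in> sets borel"
  shows "{\<omega> \<in> space M. Y n \<omega> \<in> B} \<in> sets (past n)"
proof -
  have "Y n -` B \<inter> space (past n) \<in> sets (past n)"
    by (rule measurable_sets[OF measurable_generated_sigma assms]) simp
  also have "Y n -` B \<inter> space (past n) = {\<omega> \<in> space M. Y n \<omega> \<in> B}" by auto
  finally show ?thesis .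
qed

text \<open>
  A predictor of \<open>G\<close> at time \<open>n\<close> is a version of the conditional probability of \<open>G\<close> given the past up
  to time \<open>n\<close> that depends on \<open>Y n\<close> alone. Taking it as a function on the line, with values in the unit
  interval everywhere and not just almost everywhere, makes Lipschitz estimates meaningful.
\<close>

definition predictor :: "nat \<Rightarrow> 'a set \<Rightarrow> (real \<Rightarrow> real) \<Rightarrow> bool" where
  "predictor n G h \<longleftrightarrow> h \<in> borel_measurable borel \<and> (\<forall>x. h x \<in> {0..1}) \<and>
     (\<forall>A\<in>sets (past n). prob (A \<inter> G) = (\<integral>\<omega>. indicator A \<omega> * h (Y n \<omega>) \<partial>M))"

text \<open>
  Chapman-Kolmogorov, backwards in time: the past up to time \<open>n\<close> lies in the past up to time
  \<open>Suc n\<close>, and the transition integrates out \<open>Y (Suc n)\<close>.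
\<close>

lemma predictor_step:
  assumes n: "1 \<le> n" and h: "predictor (Suc n) G h"
  shows "predictor n G (\<lambda>y. \<integral>e. h (a n * y + e) \<partial>gauss v)"
  unfolding predictor_def
proof (intro conjI allI ballI)
  have h': "h \<in> borel_measurable borel" "\<And>x. h x \<in> {0..1}" using h by (auto simp: predictor_def)
  show "(\<lambda>y. \<integral>e. h (a n * y + e) \<partial>gauss v) \<in> borel_measurable borel"
    by (rule borel_measurable_integral_gauss_shift[OF v_pos h'(1)])
  show "(\<integral>e. h (a n * y + e) \<partial>gauss v) \<in> {0..1}" for y
    by (rule integral_gauss_in_unit[OF v_pos h'])
  fix A assume A: "A \<in> sets (past n)"
  then have "A \<in> sets (past (Suc n))"
    using sets_generated_sigma_mono[of "{0..n}" "{0..Suc n}" M Y] by auto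
  then have "prob (A \<inter> G) = (\<integral>\<omega>. indicator A \<omega> * h (Y (Suc n) \<omega>) \<partial>M)"
    using h by (simp add: predictor_def)
  also have "\<dots> = (\<integral>\<omega>. indicator A \<omega> * (\<integral>e. h (a n * Y n \<omega> + e) \<partial>gauss v) \<partial>M)"
    by (rule transition[OF n A h'])
  finally show "prob (A \<inter> G) = (\<integral>\<omega>. indicator A \<omega> * (\<integral>e. h (a n * Y n \<omega> + e) \<partial>gauss v) \<partial>M)" .
qed

lemma predictor_cylinder:
  assumes "1 \<le> n" "\<And>j. C j \<in> sets borel"
  shows "\<exists>h. predictor n {\<omega> \<in> space M. \<forall>j\<le>m. Y (n + j) \<omega> \<in> C j} h"
  using assms
proof (induction m arbitrary: n C)
  case 0
  have "prob (A \<inter> {\<omega> \<in> space M. Y n \<omega> \<in> C 0}) = (\<integral>\<omega>. indicator A \<omega> * indicator (C 0) (Y n \<omega>) \<partial>M)"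
    if "A \<in> sets (past n)" for A
  proof -
    have "(\<integral>\<omega>. indicator A \<omega> * indicator (C 0) (Y n \<omega>) \<partial>M :: real) =
      (\<integral>\<omega>. indicator (A \<inter> {\<omega> \<in> space M. Y n \<omega> \<in> C 0}) \<omega> \<partial>M)"
      by (rule Bochner_Integration.integral_cong) (auto simp: indicator_def)
    also have "\<dots> = prob (A \<inter> {\<omega> \<in> space M. Y n \<omega> \<in> C 0} \<inter> space M)" by simp
    finally show ?thesis by (auto intro: arg_cong[where f=prob])
  qed
  moreover have "(indicator (C 0) :: real \<Rightarrow> real) \<in> borel_measurable borel"
    using 0(2) by simp
  ultimately have "predictor n {\<omega> \<in> space M. Y n \<omega> \<in> C 0} (indicator (C 0))"
    by (auto simp: predictor_def split: split_indicator)
  then show ?case by auto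
next
  case (Suc m)
  let ?G = "{\<omega> \<in> space M. \<forall>j\<le>m. Y (Suc n + j) \<omega> \<in> C (Suc j)}"
  from Suc.IH[of "Suc n" "\<lambda>j. C (Suc j)"] Suc.prems obtain h where "predictor (Suc n) ?G h"
    by auto
  from predictor_step[OF Suc.prems(1) this] obtain k where k: "predictor n ?G k" by blast
  have [measurable]: "C 0 \<in> sets borel" "k \<in> borel_measurable borel"
    using Suc.prems(2) k by (auto simp: predictor_def)
  have split: "{\<omega> \<in> space M. \<forall>j\<le>Suc m. Y (n + j) \<omega> \<in> C j} = {\<omega> \<in> space M. Y n \<omega> \<in> C 0} \<inter> ?G"
  proof (intro equalityI subsetI)
    fix \<omega> assume "\<omega> \<in> {\<omega> \<in> space M. \<forall>j\<le>Suc m. Y (n + j) \<omega> \<in> C j}"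
    then have \<omega>: "\<omega> \<in> space M" "\<And>j. j \<le> Suc m \<Longrightarrow> Y (n + j) \<omega> \<in> C j" by auto
    have "Y (Suc n + j) \<omega> \<in> C (Suc j)" if "j \<le> m" for j
      using \<omega>(2)[of "Suc j"] that by simp
    with \<omega>(1) \<omega>(2)[of 0] show "\<omega> \<in> {\<omega> \<in> space M. Y n \<omega> \<in> C 0} \<inter> ?G"
      by simp
  next
    fix \<omega> assume \<omega>: "\<omega> \<in> {\<omega> \<in> space M. Y n \<omega> \<in> C 0} \<inter> ?G"
    have "Y (n + j) \<omega> \<in> C j" if "j \<le> Suc m" for j
      using \<omega> that by (cases j) auto
    then show "\<omega> \<in> {\<omega> \<in> space M. \<forall>j\<le>Suc m. Y (n + j) \<omega> \<in> C j}"
      using \<omega> by auto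
  qed
  have "predictor n {\<omega> \<in> space M. \<forall>j\<le>Suc m. Y (n + j) \<omega> \<in> C j} (\<lambda>y. indicator (C 0) y * k y)"
    unfolding predictor_def
  proof (intro conjI allI ballI)
    show "(\<lambda>y. indicator (C 0) y * k y) \<in> borel_measurable borel" by measurable
    show "indicator (C 0) y * k y \<in> {0..1}" for y
      using k by (auto simp: predictor_def split: split_indicator)
    fix A assume A: "A \<in> sets (past n)"
    let ?B = "A \<inter> {\<omega> \<in> space M. Y n \<omega> \<in> C 0}"
    have "?B \<in> sets (past n)" by (intro sets.Int A past_preimage) measurable
    then have "prob (?B \<inter> ?G) = (\<integral>\<omega>. indicator ?B \<omega> * k (Y n \<omega>) \<partial>M)"
      using k by (simp add: predictor_def)
    also have "\<dots> = (\<integral>\<omega>. indicator A \<omega> * (indicator (C 0) (Y n \<omega>) * k (Y n \<omega>)) \<partial>M)"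
      by (rule Bochner_Integration.integral_cong) (auto simp: indicator_def)
    finally show "prob (A \<inter> {\<omega> \<in> space M. \<forall>j\<le>Suc m. Y (n + j) \<omega> \<in> C j}) =
      (\<integral>\<omega>. indicator A \<omega> * (indicator (C 0) (Y n \<omega>) * k (Y n \<omega>)) \<partial>M)"
      unfolding split by (simp add: Int_assoc)
  qed
  then show ?case by blast
qed

text \<open>
  Finite-dimensional future events form an intersection-stable generator of the future
  \<open>\<sigma>\<close>-algebra.
\<close>

definition cylinders :: "nat \<Rightarrow> 'a set set" where
  "cylinders n = {{\<omega> \<in> space M. \<forall>j\<le>m. Y (n + j) \<omega> \<in> C j} | m C. \<forall>j. C j \<in> sets borel}"

lemma Int_stable_cylinders: "Int_stable (cylinders n)"
proof (rule Int_stableI)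
  fix A B assume "A \<in> cylinders n" "B \<in> cylinders n"
  then obtain m C m' C' where
    A: "A = {\<omega> \<in> space M. \<forall>j\<le>m. Y (n + j) \<omega> \<in> C j}" and C: "\<And>j. C j \<in> sets borel" and
    B: "B = {\<omega> \<in> space M. \<forall>j\<le>m'. Y (n + j) \<omega> \<in> C' j}" and C': "\<And>j. C' j \<in> sets borel"
    unfolding cylinders_def by auto
  \<comment> \<open>Padding with the whole line brings both cylinders to the same length.\<close>
  let ?D = "\<lambda>j. (if j \<le> m then C j else UNIV) \<inter> (if j \<le> m' then C' j else UNIV)"
  have "A \<inter> B = {\<omega> \<in> space M. \<forall>j\<le>max m m'. Y (n + j) \<omega> \<in> ?D j}"
  proof (intro equalityI subsetI)
    fix \<omega> assume "\<omega> \<in> A \<inter> B"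
    then show "\<omega> \<in> {\<omega> \<in> space M. \<forall>j\<le>max m m'. Y (n + j) \<omega> \<in> ?D j}"
      unfolding A B by simp
  next
    fix \<omega> assume \<omega>: "\<omega> \<in> {\<omega> \<in> space M. \<forall>j\<le>max m m'. Y (n + j) \<omega> \<in> ?D j}"
    then have D: "Y (n + j) \<omega> \<in> ?D j" if "j \<le> max m m'" for j using that by blast
    have "Y (n + j) \<omega> \<in> C j" if "j \<le> m" for j using D[of j] that by simp
    moreover have "Y (n + j) \<omega> \<in> C' j" if "j \<le> m'" for j using D[of j] that by simp
    ultimately show "\<omega> \<in> A \<inter> B" unfolding A B using \<omega> by blast
  qed
  moreover have "\<forall>j. ?D j \<in> sets borel" using C C' by simp
  ultimately show "A \<inter> B \<in> cylinders n"
    unfolding cylinders_def by (intro CollectI exI[of _ "max m m'"] exI[of _ ?D] conjI)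
qed

lemma sets_future: "sets (future n) = sigma_sets (space M) (cylinders n)"
proof (rule antisym)
  show "sets (future n) \<subseteq> sigma_sets (space M) (cylinders n)"
    unfolding sets_generated_sigma
  proof (rule sigma_sets_mono, safe)
    fix s B assume s: "n \<le> s" and B: "B \<in> sets (borel :: real measure)"
    let ?C = "\<lambda>j. if j = s - n then B else UNIV"
    have "Y s -` B \<inter> space M = {\<omega> \<in> space M. \<forall>j\<le>s - n. Y (n + j) \<omega> \<in> ?C j}"
    proof (intro equalityI subsetI)
      fix \<omega> assume "\<omega> \<in> Y s -` B \<inter> space M"
      then show "\<omega> \<in> {\<omega> \<in> space M. \<forall>j\<le>s - n. Y (n + j) \<omega> \<in> ?C j}" using s by simp
    next
      fix \<omega> assume \<omega>: "\<omega> \<in> {\<omega> \<in> space M. \<forall>j\<le>s - n. Y (n + j) \<omega> \<in> ?C j}"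
      then have "Y (n + (s - n)) \<omega> \<in> ?C (s - n)" by blast
      then show "\<omega> \<in> Y s -` B \<inter> space M" using \<omega> s by simp
    qed
    moreover have "\<forall>j. ?C j \<in> sets borel" using B by auto
    ultimately have "Y s -` B \<inter> space M \<in> cylinders n"
      unfolding cylinders_def by (intro CollectI exI[of _ "s - n"] exI[of _ ?C] conjI)
    then show "Y s -` B \<inter> space M \<in> sigma_sets (space M) (cylinders n)"
      by (rule sigma_sets.Basic)
  qed
  have "cylinders n \<subseteq> sets (future n)"
  proof
    fix A assume "A \<in> cylinders n"
    then obtain m C where A: "A = {\<omega> \<in> space M. \<forall>j\<le>m. Y (n + j) \<omega> \<in> C j}"
      and C: "\<And>j. C j \<in> sets borel"
      unfolding cylinders_def by auto
    have "Y (n + j) -` C j \<inter> space (future n) \<in> sets (future n)" for j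
      by (rule measurable_sets[OF measurable_generated_sigma C]) simp
    then have "(\<Inter>j\<in>{..m}. Y (n + j) -` C j \<inter> space (future n)) \<in> sets (future n)"
      by (intro sets.finite_INT) auto
    also have "(\<Inter>j\<in>{..m}. Y (n + j) -` C j \<inter> space (future n)) = A"
      unfolding A by auto
    finally show "A \<in> sets (future n)" .
  qed
  then show "sigma_sets (space M) (cylinders n) \<subseteq> sets (future n)"
    using sets.sigma_sets_subset[of "cylinders n" "future n"] by simp
qed

text \<open>
  The sum of the predictors represents the probabilities of the union, but it may exceed 1 or diverge
  at some points of the line. Almost surely \<open>Y n\<close> avoids these points, since over the event
  \<open>{1 < H (Y n)}\<close> the integral of \<open>H (Y n)\<close> is a probability bounded by that of the event. So the sum
  may be truncated at 1.
\<close>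

lemma predictor_disjoint_union:
  fixes G :: "nat \<Rightarrow> 'a set"
  assumes disj: "disjoint_family G" and G: "\<And>i. G i \<in> sets M"
    and h: "\<And>i. predictor n (G i) (h i)"
  shows "predictor n (\<Union>i. G i) (\<lambda>y. enn2real (min 1 (\<Sum>i. ennreal (h i y))))"
proof -
  have hm[measurable]: "h i \<in> borel_measurable borel" for i using h by (simp add: predictor_def)
  have h01: "h i y \<in> {0..1}" for i y using h by (simp add: predictor_def)
  define H where "H y = (\<Sum>i. ennreal (h i y))" for y
  have [measurable]: "H \<in> borel_measurable borel" unfolding H_def by measurable
  have H: "emeasure M (A \<inter> (\<Union>i. G i)) = (\<integral>\<^sup>+\<omega>. indicator A \<omega> * H (Y n \<omega>) \<partial>M)"
    if A: "A \<in> sets (past n)" for A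
  proof -
    have AM[measurable]: "A \<in> sets M" by (rule sets_generated_sigma_events[OF A])
    have each: "emeasure M (A \<inter> G i) = (\<integral>\<^sup>+\<omega>. indicator A \<omega> * ennreal (h i (Y n \<omega>)) \<partial>M)" for i
    proof -
      have "prob (A \<inter> G i) = (\<integral>\<omega>. indicator A \<omega> * h i (Y n \<omega>) \<partial>M)"
        using h[of i] A unfolding predictor_def by blast
      then have "emeasure M (A \<inter> G i) = ennreal (\<integral>\<omega>. indicator A \<omega> * h i (Y n \<omega>) \<partial>M)"
        by (simp only: emeasure_eq_measure)
      also have "\<dots> = (\<integral>\<^sup>+\<omega>. ennreal (indicator A \<omega> * h i (Y n \<omega>)) \<partial>M)"
      proof (rule nn_integral_eq_integral_unit[symmetric])
        show "indicator A \<omega> * h i (Y n \<omega>) \<in> {0..1}" for \<omega>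
          using h01[of i "Y n \<omega>"] by (auto split: split_indicator)
      qed measurable
      also have "\<dots> = (\<integral>\<^sup>+\<omega>. indicator A \<omega> * ennreal (h i (Y n \<omega>)) \<partial>M)"
        by (rule nn_integral_cong) (simp split: split_indicator)
      finally show ?thesis .
    qed
    have "emeasure M (A \<inter> (\<Union>i. G i)) = (\<Sum>i. emeasure M (A \<inter> G i))"
    proof -
      have "disjoint_family (\<lambda>i. A \<inter> G i)" using disj by (auto simp: disjoint_family_on_def)
      then have "(\<Sum>i. emeasure M (A \<inter> G i)) = emeasure M (\<Union>i. A \<inter> G i)"
        using AM G by (intro suminf_emeasure) auto
      then show ?thesis by (simp only: Int_UN_distrib)
    qed
    also have "\<dots> = (\<Sum>i. \<integral>\<^sup>+\<omega>. indicator A \<omega> * ennreal (h i (Y n \<omega>)) \<partial>M)"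
      by (simp only: each)
    also have "\<dots> = (\<integral>\<^sup>+\<omega>. (\<Sum>i. indicator A \<omega> * ennreal (h i (Y n \<omega>))) \<partial>M)"
      by (rule nn_integral_suminf[symmetric]) measurable
    also have "\<dots> = (\<integral>\<^sup>+\<omega>. indicator A \<omega> * H (Y n \<omega>) \<partial>M)"
      by (simp only: H_def ennreal_suminf_cmult)
    finally show ?thesis .
  qed
  have H1: "AE \<omega> in M. H (Y n \<omega>) \<le> 1"
  proof -
    \<comment> \<open>On \<open>?A\<close> the integrand is larger than 1, yet its integral does not exceed the integral of 1.\<close>
    let ?A = "{\<omega> \<in> space M. Y n \<omega> \<in> {y. 1 < H y}}"
    have A: "?A \<in> sets (past n)" by (rule past_preimage) measurable
    then have AM[measurable]: "?A \<in> sets M" by (rule sets_generated_sigma_events)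
    have pt: "indicator ?A \<omega> \<le> indicator ?A \<omega> * H (Y n \<omega>)" for \<omega>
      by (auto split: split_indicator intro: less_imp_le)
    have "(\<integral>\<^sup>+\<omega>. indicator ?A \<omega> * H (Y n \<omega>) \<partial>M) \<le> emeasure M ?A"
      unfolding H[OF A, symmetric] using AM by (intro emeasure_mono) auto
    also have "\<dots> = (\<integral>\<^sup>+\<omega>. indicator ?A \<omega> \<partial>M)" by (rule nn_integral_indicator[OF AM, symmetric])
    finally have le: "(\<integral>\<^sup>+\<omega>. indicator ?A \<omega> * H (Y n \<omega>) \<partial>M) \<le> (\<integral>\<^sup>+\<omega>. indicator ?A \<omega> \<partial>M)" .
    have fin: "(\<integral>\<^sup>+\<omega>. indicator ?A \<omega> \<partial>M) \<noteq> \<infinity>"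
      unfolding nn_integral_indicator[OF AM] by simp
    have "(\<integral>\<^sup>+\<omega>. indicator ?A \<omega> * H (Y n \<omega>) - indicator ?A \<omega> \<partial>M) =
        (\<integral>\<^sup>+\<omega>. indicator ?A \<omega> * H (Y n \<omega>) \<partial>M) - (\<integral>\<^sup>+\<omega>. indicator ?A \<omega> \<partial>M)"
      by (rule nn_integral_diff[OF _ _ fin]) (measurable, rule AE_I2, rule pt)
    also have "\<dots> = 0" by (rule diff_eq_0_ennreal[OF le_less_trans[OF le] le])
         (use fin in \<open>simp only: less_top infinity_ennreal_def\<close>)
    finally have "AE \<omega> in M. indicator ?A \<omega> * H (Y n \<omega>) - indicator ?A \<omega> = 0"
      by (subst (asm) nn_integral_0_iff_AE) measurable
    with AE_space show ?thesis
    proof (eventually_elim)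
      fix \<omega> assume \<omega>: "\<omega> \<in> space M"
        and *: "indicator ?A \<omega> * H (Y n \<omega>) - indicator ?A \<omega> = 0"
      show "H (Y n \<omega>) \<le> 1"
      proof (rule ccontr)
        assume "\<not> H (Y n \<omega>) \<le> 1"
        then have "1 < H (Y n \<omega>)" by simp
        moreover from this have "indicator ?A \<omega> = (1 :: ennreal)"
          using \<omega> by simp
        ultimately show False using * diff_gr0_ennreal[of 1 "H (Y n \<omega>)"] by simp
      qed
    qed
  qed
  show ?thesis
    unfolding predictor_def H_def[symmetric]
  proof (intro conjI allI ballI)
    show "(\<lambda>y. enn2real (min 1 (H y))) \<in> borel_measurable borel" by measurable
    show u: "enn2real (min 1 (H y)) \<in> {0..1}" for y
      by (auto intro: enn2real_leI)
    fix A assume A: "A \<in> sets (past n)"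
    have [measurable]: "A \<in> sets M" by (rule sets_generated_sigma_events[OF A])
    have "ennreal (\<integral>\<omega>. indicator A \<omega> * enn2real (min 1 (H (Y n \<omega>))) \<partial>M) =
       (\<integral>\<^sup>+\<omega>. ennreal (indicator A \<omega> * enn2real (min 1 (H (Y n \<omega>)))) \<partial>M)"
      by (rule nn_integral_eq_integral_unit[symmetric])
         (use u in \<open>auto split: split_indicator\<close>)
    also have "\<dots> = (\<integral>\<^sup>+\<omega>. indicator A \<omega> * H (Y n \<omega>) \<partial>M)"
    proof (rule nn_integral_cong_AE)
      show "AE \<omega> in M. ennreal (indicator A \<omega> * enn2real (min 1 (H (Y n \<omega>)))) =
          indicator A \<omega> * H (Y n \<omega>)"
        using H1
      proof eventually_elim
        case (elim \<omega>)
        then have "H (Y n \<omega>) < top" using le_less_trans[of "H (Y n \<omega>)" 1 top] by simp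
        with elim show ?case by (simp add: min_absorb2 split: split_indicator)
      qed
    qed
    also have "\<dots> = ennreal (prob (A \<inter> (\<Union>i. G i)))"
      by (simp only: H[OF A, symmetric] emeasure_eq_measure)
    finally have eq: "ennreal (\<integral>\<omega>. indicator A \<omega> * enn2real (min 1 (H (Y n \<omega>))) \<partial>M) =
        ennreal (prob (A \<inter> (\<Union>i. G i)))" .
    have "0 \<le> (\<integral>\<omega>. indicator A \<omega> * enn2real (min 1 (H (Y n \<omega>))) \<partial>M)"
      by (rule Bochner_Integration.integral_nonneg) simp
    with eq show "prob (A \<inter> (\<Union>i. G i)) = (\<integral>\<omega>. indicator A \<omega> * enn2real (min 1 (H (Y n \<omega>))) \<partial>M)"
      by (metis ennreal_inj measure_nonneg)
  qed
qed

text \<open>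
  This is the Markov property for the whole future instead of one step, by a Dynkin argument starting
  from the cylinders.
\<close>

lemma predictor_exists:
  assumes n: "1 \<le> n" and G: "G \<in> sets (future n)"
  shows "\<exists>h. predictor n G h"
proof -
  have sub: "cylinders n \<subseteq> Pow (space M)" by (auto simp: cylinders_def)
  have "G \<in> sigma_sets (space M) (cylinders n)" using G by (simp add: sets_future)
  with Int_stable_cylinders sub show ?thesis
  proof (induction rule: sigma_sets_induct_disjoint)
    case (basic A)
    then show ?case using predictor_cylinder[OF n] by (auto simp: cylinders_def)
  next
    case empty
    have "predictor n {} (\<lambda>_. 0)" by (simp add: predictor_def)
    then show ?case by blast
  next
    case (compl G)
    then obtain h where h: "predictor n G h" by blast
    have [measurable]: "h \<in> borel_measurable borel" and h01: "h x \<in> {0..1}" for x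
      using h by (auto simp: predictor_def)
    have "G \<in> sets (future n)" using compl(1) by (simp add: sets_future)
    then have GM: "G \<in> sets M" by (rule sets_generated_sigma_events)
    have "predictor n (space M - G) (\<lambda>y. 1 - h y)"
      unfolding predictor_def
    proof (intro conjI allI ballI)
      show "(\<lambda>y. 1 - h y) \<in> borel_measurable borel" by measurable
      show "1 - h x \<in> {0..1}" for x using h01[of x] by auto
      fix A assume A: "A \<in> sets (past n)"
      have [measurable]: "A \<in> sets M" by (rule sets_generated_sigma_events[OF A])
      have "A \<inter> (space M - G) = A - A \<inter> G"
        using sets.sets_into_space[of A M] by auto
      then have "prob (A \<inter> (space M - G)) = prob A - prob (A \<inter> G)"
        using GM by (simp add: finite_measure_Diff)
      also have "\<dots> = (\<integral>\<omega>. indicator A \<omega> \<partial>M) - (\<integral>\<omega>. indicator A \<omega> * h (Y n \<omega>) \<partial>M)"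
        using h A by (simp add: predictor_def)
      also have "\<dots> = (\<integral>\<omega>. indicator A \<omega> - indicator A \<omega> * h (Y n \<omega>) \<partial>M)"
        by (intro Bochner_Integration.integral_diff[symmetric] integrable_const_bound[where B=1])
           (use h01 in \<open>auto split: split_indicator\<close>)
      finally show "prob (A \<inter> (space M - G)) = (\<integral>\<omega>. indicator A \<omega> * (1 - h (Y n \<omega>)) \<partial>M)"
        by (simp add: algebra_simps)
    qed
    then show ?case by blast
  next
    case (union G)
    then obtain h where h: "\<And>i. predictor n (G i) (h i)" by metis
    have "G i \<in> sets M" for i
    proof (rule sets_generated_sigma_events)
      show "G i \<in> sets (future n)" using union(2) by (auto simp: sets_future)
    qed
    from predictor_disjoint_union[OF union(1) this h] show ?case by blast
  qed
qed

text \<open>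
  The first transition back from time \<open>n + k\<close> smooths an arbitrary predictor, and gives the factor
  \<open>2 / v\<close>; every transition contributes its slope.
\<close>

lemma predictor_lipschitz:
  assumes "1 \<le> k" "1 \<le> n" "G \<in> sets (future (n + k))"
  shows "\<exists>h. predictor n G h \<and>
    (\<forall>x y. \<bar>h x - h y\<bar> \<le> 2 / v * (\<Prod>i\<in>{n..<n + k}. \<bar>a i\<bar>) * \<bar>x - y\<bar>)"
  using assms
proof (induction k arbitrary: n rule: nat_induct_at_least)
  case base
  obtain h where h: "predictor (Suc n) G h"
    using predictor_exists[of "Suc n" G] base by auto
  then have h': "h \<in> borel_measurable borel" "\<And>x. h x \<in> {0..1}" by (auto simp: predictor_def)
  have "\<bar>(\<integral>e. h (a n * x + e) \<partial>gauss v) - (\<integral>e. h (a n * y + e) \<partial>gauss v)\<bar>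
      \<le> 2 / v * (\<Prod>i\<in>{n..<n + 1}. \<bar>a i\<bar>) * \<bar>x - y\<bar>" for x y
    using gauss_smoothing_lipschitz[OF v_pos h', of "a n * x" "a n * y"]
    by (simp only: right_diff_distrib[symmetric] abs_mult) simp
  with predictor_step[OF base(1) h] show ?case by blast
next
  case (Suc k)
  let ?L = "2 / v * (\<Prod>i\<in>{Suc n..<Suc n + k}. \<bar>a i\<bar>)"
  obtain h where h: "predictor (Suc n) G h" and lip: "\<And>x y. \<bar>h x - h y\<bar> \<le> ?L * \<bar>x - y\<bar>"
    using Suc.IH[of "Suc n"] Suc.prems by auto
  then have h': "h \<in> borel_measurable borel" "\<And>x. h x \<in> {0..1}" by (auto simp: predictor_def)
  note [measurable] = h'(1)
  interpret V: prob_space "gauss v" by (rule prob_space_gauss[OF v_pos])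
  have "\<bar>(\<integral>e. h (a n * x + e) \<partial>gauss v) - (\<integral>e. h (a n * y + e) \<partial>gauss v)\<bar>
      \<le> 2 / v * (\<Prod>i\<in>{n..<n + Suc k}. \<bar>a i\<bar>) * \<bar>x - y\<bar>" for x y
  proof -
    have int: "integrable (gauss v) (\<lambda>e. h (a n * z + e))" for z
      by (rule integrable_gauss_bounded[OF v_pos]) (use h'(2) in auto)
    have "(\<integral>e. h (a n * x + e) \<partial>gauss v) - (\<integral>e. h (a n * y + e) \<partial>gauss v) =
        (\<integral>e. h (a n * x + e) - h (a n * y + e) \<partial>gauss v)"
      by (rule Bochner_Integration.integral_diff[OF int int, symmetric])
    also have "\<bar>\<dots>\<bar> \<le> (\<integral>e. \<bar>h (a n * x + e) - h (a n * y + e)\<bar> \<partial>gauss v)"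
      by (rule integral_abs_bound)
    also have "\<dots> \<le> (\<integral>e. ?L * \<bar>a n * x - a n * y\<bar> \<partial>gauss v)"
      using int lip[of "a n * x + e" "a n * y + e" for e] by (intro integral_mono) auto
    also have "\<dots> = ?L * (\<bar>a n\<bar> * \<bar>x - y\<bar>)"
      using V.prob_space by (simp only: right_diff_distrib[symmetric] abs_mult) simp
    also have "\<dots> = 2 / v * (\<Prod>i\<in>{n..<n + Suc k}. \<bar>a i\<bar>) * \<bar>x - y\<bar>"
      using prod.atLeast_Suc_lessThan[of n "n + Suc k" "\<lambda>i. \<bar>a i\<bar>"] by simp
    finally show ?thesis .
  qed
  with predictor_step[OF Suc.prems(1) h] show ?case by blast
qed

text \<open>
  Both \<open>P(A \<inter> G)\<close> and \<open>P(A) P(G)\<close> are close to \<open>P(A) h(0)\<close>, because \<open>h (Y n)\<close> differs from \<open>h 0\<close> by at most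
  \<open>L \<bar>Y n\<bar>\<close>; the two errors are the two summands of the bound.
\<close>

lemma covariance_le_of_lipschitz_predictor:
  assumes h: "predictor n G h" and lip: "\<And>x y. \<bar>h x - h y\<bar> \<le> L * \<bar>x - y\<bar>"
    and int: "integrable M (Y n)" and A: "A \<in> sets (past n)" and G: "G \<in> sets M"
  shows "prob (A \<inter> G) - prob A * prob G \<le>
    L * ((\<integral>\<omega>. indicator A \<omega> * \<bar>Y n \<omega>\<bar> \<partial>M) + prob A * (\<integral>\<omega>. \<bar>Y n \<omega>\<bar> \<partial>M))"
proof -
  have [measurable]: "h \<in> borel_measurable borel" and h01: "\<And>x. h x \<in> {0..1}"
    using h by (auto simp: predictor_def)
  have AM[measurable]: "A \<in> sets M" by (rule sets_generated_sigma_events[OF A])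
  have inth: "integrable M (\<lambda>\<omega>. h (Y n \<omega>))" "integrable M (\<lambda>\<omega>. indicator A \<omega> * h (Y n \<omega>))"
    by (rule integrable_const_bound[where B=1]; use h01 in \<open>auto split: split_indicator\<close>)+
  have intA: "integrable M (\<lambda>\<omega>. indicator A \<omega> * \<bar>Y n \<omega>\<bar>)"
    using integrable_mult_indicator[OF AM integrable_abs[OF int]] by simp
  have intI: "integrable M (\<lambda>\<omega>. indicator A \<omega> :: real)"
    by (rule integrable_const_bound[where B=1]) auto
  have "prob (A \<inter> G) = (\<integral>\<omega>. indicator A \<omega> * h (Y n \<omega>) \<partial>M)"
    using h A by (simp add: predictor_def)
  also have "\<dots> \<le> (\<integral>\<omega>. indicator A \<omega> * h 0 + L * (indicator A \<omega> * \<bar>Y n \<omega>\<bar>) \<partial>M)"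
  proof (rule integral_mono[OF inth(2)])
    show "integrable M (\<lambda>\<omega>. indicator A \<omega> * h 0 + L * (indicator A \<omega> * \<bar>Y n \<omega>\<bar>))"
      using intA intI by auto
    show "indicator A \<omega> * h (Y n \<omega>) \<le> indicator A \<omega> * h 0 + L * (indicator A \<omega> * \<bar>Y n \<omega>\<bar>)" for \<omega>
      using lip[of "Y n \<omega>" 0] by (auto split: split_indicator)
  qed
  also have "\<dots> = prob A * h 0 + L * (\<integral>\<omega>. indicator A \<omega> * \<bar>Y n \<omega>\<bar> \<partial>M)"
    using intA intI by simp
  finally have 1: "prob (A \<inter> G) \<le> prob A * h 0 + L * (\<integral>\<omega>. indicator A \<omega> * \<bar>Y n \<omega>\<bar> \<partial>M)" .
  have "prob (space M \<inter> G) = (\<integral>\<omega>. indicator (space M) \<omega> * h (Y n \<omega>) \<partial>M)"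
    using h sets.top[of "past n"] by (simp add: predictor_def)
  also have "\<dots> = (\<integral>\<omega>. h (Y n \<omega>) \<partial>M)"
    by (rule Bochner_Integration.integral_cong) auto
  also have "\<dots> \<ge> (\<integral>\<omega>. h 0 - L * \<bar>Y n \<omega>\<bar> \<partial>M)"
  proof (rule integral_mono[OF _ inth(1)])
    show "integrable M (\<lambda>\<omega>. h 0 - L * \<bar>Y n \<omega>\<bar>)" using int by auto
    show "h 0 - L * \<bar>Y n \<omega>\<bar> \<le> h (Y n \<omega>)" for \<omega>
      using lip[of "Y n \<omega>" 0] by auto
  qed
  also have "(\<integral>\<omega>. h 0 - L * \<bar>Y n \<omega>\<bar> \<partial>M) = h 0 - L * (\<integral>\<omega>. \<bar>Y n \<omega>\<bar> \<partial>M)"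
    using int prob_space by simp
  finally have "h 0 - L * (\<integral>\<omega>. \<bar>Y n \<omega>\<bar> \<partial>M) \<le> prob G"
    using sets.sets_into_space[OF G] by (simp add: Int_absorb1)
  then have "prob A * (h 0 - L * (\<integral>\<omega>. \<bar>Y n \<omega>\<bar> \<partial>M)) \<le> prob A * prob G"
    by (rule mult_left_mono) simp
  with 1 show ?thesis by (simp add: algebra_simps)
qed


text \<open>
  For each cell \<open>A\<close> of the first partition the second one reduces to one future event, whose
  covariance with \<open>A\<close> is at most a Lipschitz constant times the part of \<open>E\<bar>Y n\<bar>\<close> over \<open>A\<close> plus
  \<open>P(A) E\<bar>Y n\<bar>\<close>. Both sum to \<open>E\<bar>Y n\<bar>\<close> over the cells.
\<close>

lemma partition_sum_le:
  assumes k: "1 \<le> k" and n: "1 \<le> n" and int: "integrable M (Y n)"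
    and P: "P \<in> finite_partitions (generated_sigma M Y {1..n})"
    and Q: "Q \<in> finite_partitions (future (n + k))"
  shows "1 / 2 * (\<Sum>A\<in>P. \<Sum>B\<in>Q. \<bar>prob (A \<inter> B) - prob A * prob B\<bar>) \<le>
    4 / v * (\<Prod>i\<in>{n..<n + k}. \<bar>a i\<bar>) * (\<integral>\<omega>. \<bar>Y n \<omega>\<bar> \<partial>M)"
proof -
  let ?L = "2 / v * (\<Prod>i\<in>{n..<n + k}. \<bar>a i\<bar>)"
  have P': "finite P" "partition_on (space M) P" and PF: "P \<subseteq> sets (generated_sigma M Y {1..n})"
    using P by (auto simp: finite_partitions_def)
  have Q': "finite Q" "partition_on (space M) Q" and QF: "Q \<subseteq> sets (future (n + k))"
    using Q by (auto simp: finite_partitions_def)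
  have past: "A \<in> sets (past n)" if "A \<in> P" for A
    using that PF sets_generated_sigma_mono[of "{1..n}" "{0..n}" M Y] by auto
  have AM: "A \<in> sets M" if "A \<in> P" for A
    using past[OF that] by (rule sets_generated_sigma_events)
  have QM: "Q \<subseteq> sets M" using QF sets_generated_sigma_events by blast
  have each: "1 / 2 * (\<Sum>B\<in>Q. \<bar>prob (A \<inter> B) - prob A * prob B\<bar>) \<le>
     ?L * ((\<integral>\<omega>. indicator A \<omega> * \<bar>Y n \<omega>\<bar> \<partial>M) + prob A * (\<integral>\<omega>. \<bar>Y n \<omega>\<bar> \<partial>M))"
    if A: "A \<in> P" for A
  proof -
    let ?G = "\<Union>{B \<in> Q. 0 \<le> prob (A \<inter> B) - prob A * prob B}"
    have G: "?G \<in> sets (future (n + k))" using QF Q'(1) by (intro sets.finite_Union) auto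
    obtain h where h: "predictor n ?G h" "\<And>x y. \<bar>h x - h y\<bar> \<le> ?L * \<bar>x - y\<bar>"
      using predictor_lipschitz[OF k n G] by blast
    show ?thesis
      using covariance_le_of_lipschitz_predictor[OF h int past[OF A] sets_generated_sigma_events[OF G]]
      unfolding sum_abs_covariance_partition[OF Q' QM AM[OF A]] by simp
  qed
  have disj: "disjoint_family_on (\<lambda>A. A) P"
    using P'(2) by (auto simp: partition_on_def disjoint_family_on_def disjoint_def)
  have un: "\<Union>P = space M" using P'(2) by (auto simp: partition_on_def)
  have sum1: "(\<Sum>A\<in>P. prob A) = 1"
    using finite_measure_finite_Union[OF P'(1) _ disj] AM prob_space un by auto
  have intA: "integrable M (\<lambda>\<omega>. indicator A \<omega> * \<bar>Y n \<omega>\<bar>)" if "A \<in> P" for A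
    using integrable_mult_indicator[OF AM[OF that] integrable_abs[OF int]] by simp
  have "(\<Sum>A\<in>P. \<integral>\<omega>. indicator A \<omega> * \<bar>Y n \<omega>\<bar> \<partial>M) = (\<integral>\<omega>. (\<Sum>A\<in>P. indicator A \<omega> * \<bar>Y n \<omega>\<bar>) \<partial>M)"
    using intA by (subst Bochner_Integration.integral_sum) auto
  also have "\<dots> = (\<integral>\<omega>. \<bar>Y n \<omega>\<bar> \<partial>M)"
  proof (rule Bochner_Integration.integral_cong[OF refl])
    fix \<omega> assume "\<omega> \<in> space M"
    then have "(\<Sum>A\<in>P. indicator A \<omega>) = (1 :: real)"
      using indicator_UN_disjoint[OF P'(1) disj, of \<omega>] un by simp
    then show "(\<Sum>A\<in>P. indicator A \<omega> * \<bar>Y n \<omega>\<bar>) = \<bar>Y n \<omega>\<bar>"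
      by (simp flip: sum_distrib_right)
  qed
  finally have sum2: "(\<Sum>A\<in>P. \<integral>\<omega>. indicator A \<omega> * \<bar>Y n \<omega>\<bar> \<partial>M) = (\<integral>\<omega>. \<bar>Y n \<omega>\<bar> \<partial>M)" .
  have "1 / 2 * (\<Sum>A\<in>P. \<Sum>B\<in>Q. \<bar>prob (A \<inter> B) - prob A * prob B\<bar>) =
      (\<Sum>A\<in>P. 1 / 2 * (\<Sum>B\<in>Q. \<bar>prob (A \<inter> B) - prob A * prob B\<bar>))"
    by (rule sum_distrib_left)
  also have "\<dots> \<le> (\<Sum>A\<in>P. ?L * ((\<integral>\<omega>. indicator A \<omega> * \<bar>Y n \<omega>\<bar> \<partial>M) + prob A * (\<integral>\<omega>. \<bar>Y n \<omega>\<bar> \<partial>M)))"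
    by (rule sum_mono) (rule each)
  also have "\<dots> = ?L * ((\<integral>\<omega>. \<bar>Y n \<omega>\<bar> \<partial>M) + 1 * (\<integral>\<omega>. \<bar>Y n \<omega>\<bar> \<partial>M))"
    unfolding sum_distrib_left[symmetric] sum.distrib sum2 sum_distrib_right[symmetric] sum1 ..
  finally show ?thesis by simp
qed

lemma trivial_partition: "{space M} \<in> finite_partitions (generated_sigma M Y S)"
  using not_empty sets.top[of "generated_sigma M Y S"]
  by (auto simp: finite_partitions_def intro!: partition_on_space)

lemma beta_mixing_of_decay:
  assumes int: "\<And>n. 1 \<le> n \<Longrightarrow> integrable M (Y n)"
    and decay: "\<And>n k. 1 \<le> n \<Longrightarrow> (\<Prod>i\<in>{n..<n + k}. \<bar>a i\<bar>) * (\<integral>\<omega>. \<bar>Y n \<omega>\<bar> \<partial>M) \<le> c k"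
    and c: "c \<longlonglongrightarrow> 0"
  shows "beta_mixing M Y"
proof -
  have sum_le: "1 / 2 * (\<Sum>A\<in>P. \<Sum>B\<in>Q. \<bar>prob (A \<inter> B) - prob A * prob B\<bar>) \<le> 4 / v * c k"
    if "1 \<le> k" "1 \<le> n" "P \<in> finite_partitions (generated_sigma M Y {1..n})"
      "Q \<in> finite_partitions (future (n + k))" for k n P Q
  proof -
    have "4 / v * ((\<Prod>i\<in>{n..<n + k}. \<bar>a i\<bar>) * (\<integral>\<omega>. \<bar>Y n \<omega>\<bar> \<partial>M)) \<le> 4 / v * c k"
      using v_pos decay[OF that(2)] by (intro mult_left_mono) auto
    with partition_sum_le[OF that(1,2) int[OF that(2)] that(3,4)] show ?thesis
      by (simp add: mult.assoc)
  qed
  have dep: "0 \<le> beta_dependence M (generated_sigma M Y {1..n}) (future (n + k))"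
    "beta_dependence M (generated_sigma M Y {1..n}) (future (n + k)) \<le> 4 / v * c k"
    if k: "1 \<le> k" and n: "1 \<le> n" for k n
  proof -
    let ?PQ = "finite_partitions (generated_sigma M Y {1..n}) \<times> finite_partitions (future (n + k))"
    let ?f = "\<lambda>(P, Q). 1 / 2 * (\<Sum>A\<in>P. \<Sum>B\<in>Q. \<bar>prob (A \<inter> B) - prob A * prob B\<bar>)"
    have triv: "({space M}, {space M}) \<in> ?PQ" using trivial_partition by blast
    have le: "?f p \<le> 4 / v * c k" if "p \<in> ?PQ" for p
      using sum_le[OF k n] that by (auto split: prod.split)
    show "beta_dependence M (generated_sigma M Y {1..n}) (future (n + k)) \<le> 4 / v * c k"
      unfolding beta_dependence_def by (rule cSUP_least) (use triv le in blast)+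
    have "bdd_above (?f ` ?PQ)" using le by (intro bdd_aboveI2) blast
    from cSUP_upper[OF triv this]
    show "0 \<le> beta_dependence M (generated_sigma M Y {1..n}) (future (n + k))"
      unfolding beta_dependence_def using prob_space by simp
  qed
  have coeff: "beta_coeff M Y k \<in> {0..4 / v * c k}" if k: "1 \<le> k" for k
  proof -
    let ?g = "\<lambda>n. beta_dependence M (generated_sigma M Y {1..n}) (future (n + k))"
    have "beta_coeff M Y k \<le> 4 / v * c k"
      unfolding beta_coeff_def by (rule cSUP_least) (use dep(2)[OF k] in auto)
    moreover have "bdd_above (?g ` {1..})"
      by (rule bdd_aboveI2) (use dep(2)[OF k] in auto)
    then have "?g 1 \<le> beta_coeff M Y k"
      unfolding beta_coeff_def by (intro cSUP_upper) auto
    ultimately show ?thesis using dep(1)[OF k, of 1] by auto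
  qed
  have lim: "(\<lambda>k. 4 / v * c k) \<longlonglongrightarrow> 0" using tendsto_mult_left[OF c, of "4 / v"] by simp
  show ?thesis
    unfolding beta_mixing_def
  proof (rule tendsto_sandwich[OF _ _ tendsto_const lim])
    show "\<forall>\<^sub>F k in sequentially. 0 \<le> beta_coeff M Y k"
      using eventually_ge_at_top[of 1] by eventually_elim (use coeff in auto)
    show "\<forall>\<^sub>F k in sequentially. beta_coeff M Y k \<le> 4 / v * c k"
      using eventually_ge_at_top[of 1] by eventually_elim (use coeff in auto)
  qed
qed

end

section \<open>Standard deviations of the process\<close>

text \<open>
  The standard deviation of \<open>Y t\<close>: the variance of \<open>Y t + \<xi> (t + 1)\<close> is the sum of the variances and
  of twice the covariance \<open>\<rho> \<sigma> s\<close>. The start at 0 is that of the constant \<open>Y 0\<close> and gives \<open>\<sigma>\<close> at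
  time 1.
\<close>

fun std_dev :: "real \<Rightarrow> real \<Rightarrow> nat \<Rightarrow> real" where
  "std_dev \<rho> \<sigma> 0 = 0"
| "std_dev \<rho> \<sigma> (Suc t) = sqrt ((std_dev \<rho> \<sigma> t)\<^sup>2 + 2 * \<rho> * \<sigma> * std_dev \<rho> \<sigma> t + \<sigma>\<^sup>2)"

lemma std_dev_Suc_square:
  assumes "\<bar>\<rho>\<bar> < 1"
  shows "(std_dev \<rho> \<sigma> (Suc t))\<^sup>2 = (std_dev \<rho> \<sigma> t + \<rho> * \<sigma>)\<^sup>2 + \<sigma>\<^sup>2 * (1 - \<rho>\<^sup>2)"
proof -
  have "(std_dev \<rho> \<sigma> t)\<^sup>2 + 2 * \<rho> * \<sigma> * std_dev \<rho> \<sigma> t + \<sigma>\<^sup>2 =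
    (std_dev \<rho> \<sigma> t + \<rho> * \<sigma>)\<^sup>2 + \<sigma>\<^sup>2 * (1 - \<rho>\<^sup>2)"
    by (simp add: power2_eq_square algebra_simps)
  moreover have "(std_dev \<rho> \<sigma> t + \<rho> * \<sigma>)\<^sup>2 + \<sigma>\<^sup>2 * (1 - \<rho>\<^sup>2) \<ge> 0"
    using assms by (intro add_nonneg_nonneg mult_nonneg_nonneg) (auto simp: abs_square_le_1)
  ultimately show ?thesis by simp
qed

lemma std_dev_nonneg: "0 \<le> std_dev \<rho> \<sigma> t" if "\<bar>\<rho>\<bar> < 1"
proof (cases t)
  case (Suc n)
  have "0 \<le> (std_dev \<rho> \<sigma> n + \<rho> * \<sigma>)\<^sup>2 + \<sigma>\<^sup>2 * (1 - \<rho>\<^sup>2)"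
    using that by (intro add_nonneg_nonneg mult_nonneg_nonneg) (auto simp: abs_square_le_1)
  also have "\<dots> = (std_dev \<rho> \<sigma> n)\<^sup>2 + 2 * \<rho> * \<sigma> * std_dev \<rho> \<sigma> n + \<sigma>\<^sup>2"
    by (simp add: power2_eq_square algebra_simps)
  finally show ?thesis using Suc by simp
qed simp

lemma std_dev_pos:
  assumes "\<bar>\<rho>\<bar> < 1" "0 < \<sigma>" "1 \<le> t"
  shows "0 < std_dev \<rho> \<sigma> t"
proof -
  obtain n where t: "t = Suc n" using assms(3) by (cases t) auto
  have "0 < \<sigma>\<^sup>2 * (1 - \<rho>\<^sup>2)" using assms by (simp add: abs_square_less_1)
  then have "0 < (std_dev \<rho> \<sigma> t)\<^sup>2"
    unfolding t std_dev_Suc_square[OF assms(1)] by (intro add_nonneg_pos) auto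
  then show ?thesis using std_dev_nonneg[OF assms(1), of \<sigma> t] by (simp add: less_le)
qed

text \<open>
  The convex map \<open>s \<mapsto> s\<^sup>2 - 2 \<bar>\<rho>\<bar> \<sigma> s + \<sigma>\<^sup>2\<close> takes its maximum over \<open>0 \<le> s \<le> \<sigma>/\<bar>\<rho>\<bar>\<close> at an end point, where
  it is at most \<open>(\<sigma>/\<bar>\<rho>\<bar>)\<^sup>2\<close>. The proof displays the difference as a sum of two nonnegative products.
\<close>

lemma std_dev_le:
  assumes \<rho>: "-1 < \<rho>" "\<rho> < 0" and \<sigma>: "0 < \<sigma>"
  shows "std_dev \<rho> \<sigma> t \<le> \<sigma> / \<bar>\<rho>\<bar>"
proof (induction t)
  case 0
  then show ?case using \<sigma> by simp
next
  case (Suc t)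
  let ?s = "std_dev \<rho> \<sigma> t" and ?M = "\<sigma> / \<bar>\<rho>\<bar>"
  have s: "0 \<le> ?s" using std_dev_nonneg[of \<rho> \<sigma> t] \<rho> by simp
  have "?M\<^sup>2 - (?s\<^sup>2 + 2 * \<rho> * \<sigma> * ?s + \<sigma>\<^sup>2) =
      (?M - ?s) * (?M - \<rho>\<^sup>2 * ?M + ?s) + \<rho>\<^sup>2 * ?M * ?s"
    using \<rho> by (simp add: power2_eq_square field_simps)
  moreover have "0 \<le> (?M - ?s) * (?M - \<rho>\<^sup>2 * ?M + ?s) + \<rho>\<^sup>2 * ?M * ?s"
  proof -
    have M: "0 \<le> ?M" using \<sigma> by simp
    have "\<rho>\<^sup>2 * ?M \<le> 1 * ?M"
      using \<rho> M by (intro mult_right_mono) (auto simp: abs_square_le_1)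
    then have "0 \<le> ?M - \<rho>\<^sup>2 * ?M + ?s" using s by simp
    moreover have "0 \<le> ?M - ?s" using Suc by simp
    ultimately have "0 \<le> (?M - ?s) * (?M - \<rho>\<^sup>2 * ?M + ?s)" by (intro mult_nonneg_nonneg)
    moreover have "0 \<le> \<rho>\<^sup>2 * ?M * ?s" using s M by (intro mult_nonneg_nonneg) simp_all
    ultimately show ?thesis by (rule add_nonneg_nonneg)
  qed
  ultimately have "?s\<^sup>2 + 2 * \<rho> * \<sigma> * ?s + \<sigma>\<^sup>2 \<le> ?M\<^sup>2" by linarith
  then have "sqrt (?s\<^sup>2 + 2 * \<rho> * \<sigma> * ?s + \<sigma>\<^sup>2) \<le> ?M"
    using \<sigma> by (intro real_le_lsqrt) auto
  then show ?case by simp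
qed

text \<open>
  The quotient of the two sides without the factor \<open>sqrt (1 - \<rho>\<^sup>2 (1 - \<rho>\<^sup>2))\<close> is the absolute
  correlation of \<open>Y t\<close> and \<open>Y (Suc t)\<close>. Its distance from 1 is governed by the share of the
  innovation variance \<open>\<sigma>\<^sup>2 (1 - \<rho>\<^sup>2)\<close> in that of \<open>Y (Suc t)\<close>, which is at most \<open>(\<sigma>/\<bar>\<rho>\<bar>)\<^sup>2\<close>.
\<close>

lemma std_dev_contraction:
  assumes \<rho>: "-1 < \<rho>" "\<rho> < 0" and \<sigma>: "0 < \<sigma>"
  shows "\<bar>std_dev \<rho> \<sigma> t + \<rho> * \<sigma>\<bar> \<le> sqrt (1 - \<rho>\<^sup>2 * (1 - \<rho>\<^sup>2)) * std_dev \<rho> \<sigma> (Suc t)"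
proof -
  let ?s = "std_dev \<rho> \<sigma> (Suc t)"
  have r: "\<bar>\<rho>\<bar> < 1" using \<rho> by simp
  have q: "0 < \<rho>\<^sup>2" "\<rho>\<^sup>2 < 1" using \<rho> by (auto simp: abs_square_less_1)
  have s: "0 \<le> ?s" by (rule std_dev_nonneg[OF r])
  have "?s\<^sup>2 \<le> (\<sigma> / \<bar>\<rho>\<bar>)\<^sup>2" by (rule power_mono[OF std_dev_le[OF assms] s])
  then have "?s\<^sup>2 * \<rho>\<^sup>2 \<le> \<sigma>\<^sup>2" using q by (simp add: power_divide field_simps)
  then have "?s\<^sup>2 * \<rho>\<^sup>2 * (1 - \<rho>\<^sup>2) \<le> \<sigma>\<^sup>2 * (1 - \<rho>\<^sup>2)" using q by (intro mult_right_mono) auto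
  then have "(std_dev \<rho> \<sigma> t + \<rho> * \<sigma>)\<^sup>2 \<le> (1 - \<rho>\<^sup>2 * (1 - \<rho>\<^sup>2)) * ?s\<^sup>2"
    using std_dev_Suc_square[OF r, of \<sigma> t] by (simp add: algebra_simps)
  then have "sqrt ((std_dev \<rho> \<sigma> t + \<rho> * \<sigma>)\<^sup>2) \<le> sqrt ((1 - \<rho>\<^sup>2 * (1 - \<rho>\<^sup>2)) * ?s\<^sup>2)"
    by (rule real_sqrt_le_mono)
  then show ?thesis using s by (simp add: real_sqrt_mult)
qed

section \<open>The Gaussian convolution process as a linear Gaussian chain\<close>

context gaussian_convolution_markov_process
begin

lemma Y_borel [measurable]: "Y t \<in> borel_measurable M"
  using markov by (simp add: markov_process_def)

context
  assumes sigma_pos: "0 < \<sigma>" and rho: "\<bar>\<rho>\<bar> < 1"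
begin

lemma innovation_borel [measurable]: "1 \<le> t \<Longrightarrow> \<xi> t \<in> borel_measurable M"
  using distributed_measurable[OF innovation] by simp

lemma innovation_law: "1 \<le> t \<Longrightarrow> distr M borel (\<xi> t) = gauss \<sigma>"
  using innovation distributed_iff_gauss[OF innovation_borel] by simp

lemma innovation_joint_law:
  assumes t: "1 \<le> t" and law: "distr M borel (Y t) = gauss (std_dev \<rho> \<sigma> t)"
  shows "distr M (borel \<Otimes>\<^sub>M borel) (\<lambda>\<omega>. (Y t \<omega>, Y (Suc t) \<omega>)) =
    distr (gauss (std_dev \<rho> \<sigma> t) \<Otimes>\<^sub>M gauss (\<sigma> * sqrt (1 - \<rho>\<^sup>2))) (borel \<Otimes>\<^sub>M borel)
      (\<lambda>(x, e). (x, (1 + \<rho> * \<sigma> / std_dev \<rho> \<sigma> t) * x + e))"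
proof -
  let ?s = "std_dev \<rho> \<sigma> t"
  have [measurable]: "\<xi> (Suc t) \<in> borel_measurable M" by (rule innovation_borel) simp
  obtain C where C: "is_gaussian_copula \<rho> C" "\<And>t. t \<ge> 2 \<Longrightarrow> has_copula M (Y (t - 1)) (\<xi> t) C"
    using copula by blast
  have "has_copula M (Y t) (\<xi> (Suc t)) C" using C(2)[of "Suc t"] t by simp
  then have *: "distr M (borel \<Otimes>\<^sub>M borel) (\<lambda>\<omega>. (Y t \<omega>, \<xi> (Suc t) \<omega>)) =
    distr (gauss ?s \<Otimes>\<^sub>M gauss (\<sigma> * sqrt (1 - \<rho>\<^sup>2))) (borel \<Otimes>\<^sub>M borel)
      (\<lambda>(x, e). (x, \<rho> * \<sigma> / ?s * x + e))"
    using std_dev_pos[OF rho sigma_pos t] law innovation_law[of "Suc t"] C(1)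
    by (intro gaussian_copula_joint_law[OF prob_space_axioms rho _ sigma_pos]) auto
  have "distr M (borel \<Otimes>\<^sub>M borel) (\<lambda>\<omega>. (Y t \<omega>, Y (Suc t) \<omega>)) =
    distr M (borel \<Otimes>\<^sub>M borel) (\<lambda>\<omega>. (Y t \<omega>, Y t \<omega> + \<xi> (Suc t) \<omega>))"
    by (rule distr_cong) (use step[of "Suc t"] in auto)
  also have "\<dots> = distr (distr M (borel \<Otimes>\<^sub>M borel) (\<lambda>\<omega>. (Y t \<omega>, \<xi> (Suc t) \<omega>)))
      (borel \<Otimes>\<^sub>M borel) (\<lambda>(x, z). (x, x + z))"
    by (subst distr_distr) (auto simp: comp_def)
  also have "\<dots> = distr (gauss ?s \<Otimes>\<^sub>M gauss (\<sigma> * sqrt (1 - \<rho>\<^sup>2))) (borel \<Otimes>\<^sub>M borel)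
      (\<lambda>(x, e). (x, (1 + \<rho> * \<sigma> / ?s) * x + e))"
    unfolding * by (subst distr_distr) (auto simp: comp_def split_beta' algebra_simps)
  finally show ?thesis .
qed

text \<open>
  The marginal and the joint laws support each other in an induction: the law of \<open>Y t\<close> is needed to
  read the copula relation, and this gives the law of \<open>Y (Suc t)\<close> as that of \<open>a t * Y t\<close> plus independent
  normal noise.
\<close>

lemma Y_law: "1 \<le> t \<Longrightarrow> distr M borel (Y t) = gauss (std_dev \<rho> \<sigma> t)"
proof (induction t rule: nat_induct_at_least)
  case base
  have "distr M borel (Y 1) = distr M borel (\<xi> 1)"
    by (rule distr_cong) (use step[of 1] start in auto)
  then show ?case using innovation_law[of 1] sigma_pos by simp
next
  case (Suc t)
  let ?s = "std_dev \<rho> \<sigma> t" and ?v = "\<sigma> * sqrt (1 - \<rho>\<^sup>2)"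
  have s: "0 < ?s" by (rule std_dev_pos[OF rho sigma_pos Suc.hyps])
  have q: "0 < 1 - \<rho>\<^sup>2" using rho by (simp add: abs_square_less_1)
  have "distr M borel (Y (Suc t)) =
    distr (distr M (borel \<Otimes>\<^sub>M borel) (\<lambda>\<omega>. (Y t \<omega>, Y (Suc t) \<omega>))) borel snd"
    by (subst distr_distr) (auto simp: comp_def)
  also have "\<dots> = distr (gauss ?s \<Otimes>\<^sub>M gauss ?v) borel (\<lambda>(x, e). (1 + \<rho> * \<sigma> / ?s) * x + e)"
    unfolding innovation_joint_law[OF Suc.hyps Suc.IH]
    by (subst distr_distr) (auto simp: comp_def split_beta')
  also have "\<dots> = gauss (sqrt ((1 + \<rho> * \<sigma> / ?s)\<^sup>2 * ?s\<^sup>2 + ?v\<^sup>2))"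
    using s q sigma_pos by (intro distr_gauss_pair_affine) auto
  also have "(1 + \<rho> * \<sigma> / ?s)\<^sup>2 * ?s\<^sup>2 + ?v\<^sup>2 = (?s + \<rho> * \<sigma>)\<^sup>2 + \<sigma>\<^sup>2 * (1 - \<rho>\<^sup>2)"
    using s q by (simp add: power_mult_distrib[symmetric] distrib_right) (simp add: power_mult_distrib)
  also have "\<dots> = (std_dev \<rho> \<sigma> (Suc t))\<^sup>2"
    by (rule std_dev_Suc_square[OF rho, symmetric])
  also have "sqrt \<dots> = std_dev \<rho> \<sigma> (Suc t)"
    using std_dev_nonneg[OF rho] by (rule real_sqrt_unique[OF refl])
  finally show ?case .
qed

lemma expectation_abs_Y:
  assumes t: "1 \<le> t"
  shows "integrable M (Y t)" and "(\<integral>\<omega>. \<bar>Y t \<omega>\<bar> \<partial>M) \<le> std_dev \<rho> \<sigma> t"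
proof -
  let ?s = "std_dev \<rho> \<sigma> t"
  have s: "0 < ?s" by (rule std_dev_pos[OF rho sigma_pos t])
  have D: "distributed M lborel (Y t) (normal_density 0 ?s)"
    using Y_law[OF t] by (subst distributed_iff_gauss) auto
  show "integrable M (Y t)"
    by (rule distributed_integrable_var[OF D]) (use integrable_normal_moment_nz_1[OF s] in auto)
  have "(\<integral>\<omega>. \<bar>Y t \<omega>\<bar> \<partial>M) = (\<integral>x. normal_density 0 ?s x * \<bar>x\<bar> \<partial>lborel)"
    by (rule distributed_integral[OF D, symmetric]) auto
  also have "\<dots> = ?s * sqrt (2 / pi)"
    using integral_normal_moment_abs_odd[OF s, of 0 0] by simp
  also have "\<dots> \<le> ?s * 1" using s pi_ge_two by (intro mult_left_mono) auto
  finally show "(\<integral>\<omega>. \<bar>Y t \<omega>\<bar> \<partial>M) \<le> ?s" by simp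
qed

lemma is_linear_gaussian_chain:
  "linear_gaussian_chain M Y (\<lambda>t. 1 + \<rho> * \<sigma> / std_dev \<rho> \<sigma> t) (\<sigma> * sqrt (1 - \<rho>\<^sup>2))"
proof
  show v: "0 < \<sigma> * sqrt (1 - \<rho>\<^sup>2)" using sigma_pos rho by (simp add: abs_square_less_1)
  fix t A and Q :: "real \<Rightarrow> real"
  assume t: "1 \<le> t" and A: "A \<in> sets (generated_sigma M Y {0..t})"
    and Q: "Q \<in> borel_measurable borel" "\<And>x. Q x \<in> {0..1}"
  have X: "vimage_algebra (space M) (Y t) borel = generated_sigma M Y {t}"
    by (simp add: generated_sigma_def vimage_algebra_def)
  show "(\<integral>\<omega>. indicator A \<omega> * Q (Y (Suc t) \<omega>) \<partial>M) =
      (\<integral>\<omega>. indicator A \<omega> * (\<integral>e. Q ((1 + \<rho> * \<sigma> / std_dev \<rho> \<sigma> t) * Y t \<omega> + e)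
         \<partial>gauss (\<sigma> * sqrt (1 - \<rho>\<^sup>2))) \<partial>M)"
  proof (rule one_step_kernel[OF v _ _ _ _ _ _ A Q])
    show "subalgebra M (generated_sigma M Y {0..t})"
      by (simp add: subalgebra_def sets_generated_sigma_subset)
    show "Y t \<in> borel_measurable (generated_sigma M Y {0..t})"
      by (rule measurable_generated_sigma) simp
    show "distr M (borel \<Otimes>\<^sub>M borel) (\<lambda>\<omega>. (Y t \<omega>, Y (Suc t) \<omega>)) =
      distr (distr M borel (Y t) \<Otimes>\<^sub>M gauss (\<sigma> * sqrt (1 - \<rho>\<^sup>2))) (borel \<Otimes>\<^sub>M borel)
      (\<lambda>(x, e). (x, (1 + \<rho> * \<sigma> / std_dev \<rho> \<sigma> t) * x + e))"
      using innovation_joint_law[OF t Y_law[OF t]] Y_law[OF t] by simp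
  qed (use markov in \<open>auto simp: markov_process_def X\<close>)
qed measurable

end
end

section \<open>Exponential decay and absolute regularity\<close>

text \<open>
  Telescoping: \<open>\<bar>a i\<bar> s\<^sub>i \<le> r s\<^sub>i\<^sub>+\<^sub>1\<close> even when \<open>\<bar>a i\<bar>\<close> itself is larger than 1.
\<close>

lemma slope_product_decay:
  assumes \<rho>: "-1 < \<rho>" "\<rho> < 0" and \<sigma>: "0 < \<sigma>" and n: "1 \<le> n"
  shows "(\<Prod>i\<in>{n..<n + k}. \<bar>1 + \<rho> * \<sigma> / std_dev \<rho> \<sigma> i\<bar>) * std_dev \<rho> \<sigma> n \<le>
    sqrt (1 - \<rho>\<^sup>2 * (1 - \<rho>\<^sup>2)) ^ k * std_dev \<rho> \<sigma> (n + k)"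
proof (induction k)
  case 0
  then show ?case by simp
next
  case (Suc k)
  let ?r = "sqrt (1 - \<rho>\<^sup>2 * (1 - \<rho>\<^sup>2))" and ?s = "std_dev \<rho> \<sigma>"
  have r: "0 \<le> ?r"
    using \<rho> by (simp add: mult_le_one abs_square_le_1)
  have s: "0 < ?s (n + k)" using std_dev_pos[of \<rho> \<sigma> "n + k"] \<rho> \<sigma> n by simp
  have "(\<Prod>i\<in>{n..<n + Suc k}. \<bar>1 + \<rho> * \<sigma> / ?s i\<bar>) * ?s n =
     ((\<Prod>i\<in>{n..<n + k}. \<bar>1 + \<rho> * \<sigma> / ?s i\<bar>) * ?s n) * \<bar>1 + \<rho> * \<sigma> / ?s (n + k)\<bar>"
    by simp
  also have "\<dots> \<le> (?r ^ k * ?s (n + k)) * \<bar>1 + \<rho> * \<sigma> / ?s (n + k)\<bar>"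
    by (rule mult_right_mono[OF Suc.IH]) simp
  also have "\<dots> = ?r ^ k * \<bar>?s (n + k) + \<rho> * \<sigma>\<bar>"
  proof -
    have "?s (n + k) * \<bar>1 + \<rho> * \<sigma> / ?s (n + k)\<bar> = \<bar>?s (n + k) * (1 + \<rho> * \<sigma> / ?s (n + k))\<bar>"
      using s by (simp only: abs_mult abs_of_pos)
    also have "?s (n + k) * (1 + \<rho> * \<sigma> / ?s (n + k)) = ?s (n + k) + \<rho> * \<sigma>"
      using s by (simp add: field_simps)
    finally show ?thesis by (simp only: mult.assoc)
  qed
  also have "\<dots> \<le> ?r ^ k * (?r * ?s (Suc (n + k)))"
    using r by (intro mult_left_mono std_dev_contraction[OF \<rho> \<sigma>]) auto
  finally show ?case by (simp add: mult_ac)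
qed

theorem corollary3p1:
  fixes M :: "'a measure" and Y \<xi> :: "nat \<Rightarrow> 'a \<Rightarrow> real" and \<rho> \<sigma> :: real
  assumes "\<sigma> > 0" and "\<rho> \<in> {-1<..<0}"
    and "gaussian_convolution_markov_process M Y \<xi> \<rho> \<sigma>"
  shows "beta_mixing M Y"
proof -
  interpret gaussian_convolution_markov_process M Y \<xi> \<rho> \<sigma> by fact
  have \<rho>: "-1 < \<rho>" "\<rho> < 0" "\<bar>\<rho>\<bar> < 1" using assms(2) by auto
  interpret chain: linear_gaussian_chain M Y "\<lambda>t. 1 + \<rho> * \<sigma> / std_dev \<rho> \<sigma> t" "\<sigma> * sqrt (1 - \<rho>\<^sup>2)"
    by (rule is_linear_gaussian_chain[OF assms(1) \<rho>(3)])
  let ?r = "sqrt (1 - \<rho>\<^sup>2 * (1 - \<rho>\<^sup>2))"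
  have q: "0 < \<rho>\<^sup>2" "\<rho>\<^sup>2 < 1" using \<rho> by (auto simp: abs_square_less_1)
  have r: "0 \<le> ?r" "?r < 1" using q by (auto simp: mult_le_one)
  show ?thesis
  proof (rule chain.beta_mixing_of_decay)
    show "integrable M (Y n)" if "1 \<le> n" for n
      by (rule expectation_abs_Y(1)[OF assms(1) \<rho>(3) that])
    show "(\<lambda>k. ?r ^ k * (\<sigma> / \<bar>\<rho>\<bar>)) \<longlonglongrightarrow> 0"
      using tendsto_mult_right[OF LIMSEQ_realpow_zero[OF r], of "\<sigma> / \<bar>\<rho>\<bar>"] by simp
    fix n k :: nat assume n: "1 \<le> n"
    let ?p = "\<Prod>i\<in>{n..<n + k}. \<bar>1 + \<rho> * \<sigma> / std_dev \<rho> \<sigma> i\<bar>"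
    have "?p * (\<integral>\<omega>. \<bar>Y n \<omega>\<bar> \<partial>M) \<le> ?p * std_dev \<rho> \<sigma> n"
      by (intro mult_left_mono expectation_abs_Y(2)[OF assms(1) \<rho>(3) n] prod_nonneg) auto
    also have "\<dots> \<le> ?r ^ k * std_dev \<rho> \<sigma> (n + k)"
      by (rule slope_product_decay[OF \<rho>(1,2) assms(1) n])
    also have "\<dots> \<le> ?r ^ k * (\<sigma> / \<bar>\<rho>\<bar>)"
      using r by (intro mult_left_mono std_dev_le[OF \<rho>(1,2) assms(1)]) auto
    finally show "?p * (\<integral>\<omega>. \<bar>Y n \<omega>\<bar> \<partial>M) \<le> ?r ^ k * (\<sigma> / \<bar>\<rho>\<bar>)" .
  qed
qed

end
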